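(* Let $R$ be a commutative ring with identity, let $\Gamma$ be a well-founded ordered monoid whose neutral element $e$ is the least element of $\Gamma$, and let $A$ be a $\Gamma$-graded $R$-algebra with finite support. Let $M$ be a $\Gamma$-graded $A$-module with finite support, and let $P_\bullet$ be a minimal projective resolution of $M$ in the category $A\text{-}\Gamma\text{-gr}$. Then $P_\bullet$, with the grading forgotten, is a minimal projective resolution of $M$ in the category $A\text{-Mod}$. In other words, the grading-forgetting functor from $A\text{-}\Gamma\text{-gr}$ to $A\text{-Mod}$ preserves minimal projective resolutions of $\Gamma$-graded $A$-modules with finite support.
   Context: Ordered monoid: a monoid $\Gamma$ with a (partial) order $<$ such that for all $\alpha,\beta,\gamma\in\Gamma$ with $\alpha<\beta$ one has $\alpha\gamma<\beta\gamma$ and $\gamma\alpha<\gamma\beta$ (strict inequalities are preserved). It is well-founded if every strictly decreasing sequence of elements is finite. A $\Gamma$-graded associative $R$-algebra is an associative $R$-algebra $A$ with identity $e_A$ together with an $R$-module decomposition $A=\bigoplus_{\gamma\in\Gamma}A_\gamma$ with $A_{\gamma_1}A_{\gamma_2}\subset A_{\gamma_1\gamma_2}$ for all $\gamma_1,\gamma_2\in\Gamma$, and with $e_A\in A_e$. A left $A$-module $M$ is $\Gamma$-graded if $M=\bigoplus_{\gamma\in\Gamma}M_\gamma$ with each $M_\gamma$ an $R$-submodule and $A_{\gamma_1}M_{\gamma_2}\subset M_{\gamma_1\gamma_2}$ for all $\gamma_1,\gamma_2$. The category $A\text{-}\Gamma\text{-gr}$ has as objects the left $\Gamma$-graded $A$-modules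 and as morphisms the $A$-module homomorphisms $f\colon M_1\to M_2$ with $f(M_{1,\gamma})\subset M_{2,\gamma}$ for all $\gamma$; it is an abelian category. $A\text{-Mod}$ is the category of left $A$-modules. The support of a graded module is $\operatorname{supp}(M)=\{\gamma\in\Gamma : M_\gamma\neq 0\}$, and similarly for $A$. In an abelian category, a subobject $N$ of $M$ is superfluous if for every subobject $T$ of $M$, $N+T=M$ implies $T=M$. (In $A\text{-}\Gamma\text{-gr}$ subobjects are graded submodules; in $A\text{-Mod}$ they are arbitrary submodules.) A projective resolution of $M$ is an exact complex $\cdots\to P_1\to P_0\to P_{-1}=M\to 0$ with differentials $d_k\colon P_{k+1}\to P_k$ ($k\ge -1$) and $P_k$ projective for $k\ge 0$. It is minimal if $\ker(d_k)$ is a superfluous subobject of $P_{k+1}$ for all $k\ge -1$. *)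

theory Defs
  imports "HOL-Algebra.AbelCoset" "HOL-Algebra.Module"
begin

section \<open>Ordered monoids\<close>

locale ordered_monoid = monoid \<Gamma> for \<Gamma> :: "('g, 'w) monoid_scheme" (structure) +
  fixes lt :: "'g \<Rightarrow> 'g \<Rightarrow> bool"
  assumes less_irrefl: "\<alpha> \<in> carrier \<Gamma> \<Longrightarrow> \<not> lt \<alpha> \<alpha>"
    and less_trans: "\<lbrakk>\<alpha> \<in> carrier \<Gamma>; \<beta> \<in> carrier \<Gamma>; \<gamma> \<in> carrier \<Gamma>; lt \<alpha> \<beta>; lt \<beta> \<gamma>\<rbrakk> \<Longrightarrow> lt \<alpha> \<gamma>"
    and mult_less_right: "\<lbrakk>\<alpha> \<in> carrier \<Gamma>; \<beta> \<in> carrier \<Gamma>; \<gamma> \<in> carrier \<Gamma>; lt \<alpha> \<beta>\<rbrakk> \<Longrightarrow> lt (\<alpha> \<otimes> \<gamma>) (\<beta> \<otimes> \<gamma>)"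
    and mult_less_left: "\<lbrakk>\<alpha> \<in> carrier \<Gamma>; \<beta> \<in> carrier \<Gamma>; \<gamma> \<in> carrier \<Gamma>; lt \<alpha> \<beta>\<rbrakk> \<Longrightarrow> lt (\<gamma> \<otimes> \<alpha>) (\<gamma> \<otimes> \<beta>)"

locale well_founded_ordered_monoid = ordered_monoid \<Gamma> lt
  for \<Gamma> :: "('g, 'w) monoid_scheme" (structure) and lt :: "'g \<Rightarrow> 'g \<Rightarrow> bool" +
  assumes no_infinite_descent:
    "\<not> (\<exists>s :: nat \<Rightarrow> 'g. (\<forall>i. s i \<in> carrier \<Gamma>) \<and> (\<forall>i. lt (s (Suc i)) (s i)))"


section \<open>Algebras and left modules\<close>

text \<open>The library locales \<open>algebra\<close> and \<open>module\<close> require the algebra, respectively the ring of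
  scalars, to be commutative.  The records \<open>module\<close> and the locale \<open>submodule\<close> carry no such
  restriction and are reused.\<close>

locale assoc_algebra = module R A + ring A for R (structure) and A (structure) +
  assumes smult_mult_left: "\<lbrakk>r \<in> carrier R; a \<in> carrier A; b \<in> carrier A\<rbrakk> \<Longrightarrow>
      (r \<odot>\<^bsub>A\<^esub> a) \<otimes>\<^bsub>A\<^esub> b = r \<odot>\<^bsub>A\<^esub> (a \<otimes>\<^bsub>A\<^esub> b)"
    and smult_mult_right: "\<lbrakk>r \<in> carrier R; a \<in> carrier A; b \<in> carrier A\<rbrakk> \<Longrightarrow>
      a \<otimes>\<^bsub>A\<^esub> (r \<odot>\<^bsub>A\<^esub> b) = r \<odot>\<^bsub>A\<^esub> (a \<otimes>\<^bsub>A\<^esub> b)"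

locale left_module = A?: ring A + M?: abelian_group M
  for A :: "('a, 'z) ring_scheme" (structure) and M :: "('a, 'm, 'x) module_scheme" (structure) +
  assumes smult_closed: "\<lbrakk>a \<in> carrier A; x \<in> carrier M\<rbrakk> \<Longrightarrow> a \<odot>\<^bsub>M\<^esub> x \<in> carrier M"
    and smult_l_distr: "\<lbrakk>a \<in> carrier A; b \<in> carrier A; x \<in> carrier M\<rbrakk> \<Longrightarrow>
      (a \<oplus>\<^bsub>A\<^esub> b) \<odot>\<^bsub>M\<^esub> x = a \<odot>\<^bsub>M\<^esub> x \<oplus>\<^bsub>M\<^esub> b \<odot>\<^bsub>M\<^esub> x"
    and smult_r_distr: "\<lbrakk>a \<in> carrier A; x \<in> carrier M; y \<in> carrier M\<rbrakk> \<Longrightarrow>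
      a \<odot>\<^bsub>M\<^esub> (x \<oplus>\<^bsub>M\<^esub> y) = a \<odot>\<^bsub>M\<^esub> x \<oplus>\<^bsub>M\<^esub> a \<odot>\<^bsub>M\<^esub> y"
    and smult_assoc: "\<lbrakk>a \<in> carrier A; b \<in> carrier A; x \<in> carrier M\<rbrakk> \<Longrightarrow>
      (a \<otimes>\<^bsub>A\<^esub> b) \<odot>\<^bsub>M\<^esub> x = a \<odot>\<^bsub>M\<^esub> (b \<odot>\<^bsub>M\<^esub> x)"
    and smult_one: "x \<in> carrier M \<Longrightarrow> \<one>\<^bsub>A\<^esub> \<odot>\<^bsub>M\<^esub> x = x"

definition left_module_hom ::
  "('a, 'z) ring_scheme \<Rightarrow> ('a, 'm, 'x) module_scheme \<Rightarrow> ('a, 'n, 'y) module_scheme \<Rightarrow> ('m \<Rightarrow> 'n) set"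
  where "left_module_hom A M N = {f \<in> carrier M \<rightarrow> carrier N.
    (\<forall>x \<in> carrier M. \<forall>y \<in> carrier M. f (x \<oplus>\<^bsub>M\<^esub> y) = f x \<oplus>\<^bsub>N\<^esub> f y) \<and>
    (\<forall>a \<in> carrier A. \<forall>x \<in> carrier M. f (a \<odot>\<^bsub>M\<^esub> x) = a \<odot>\<^bsub>N\<^esub> f x)}"

text \<open>The \<open>R\<close>-module underlying a left module over the \<open>R\<close>-algebra \<open>A\<close>: \<open>r\<close> acts as
  \<open>r \<cdot> 1\<^sub>A\<close>.  (The record fields \<open>mult\<close> and \<open>one\<close> are meaningless for modules.)\<close>

definition restrict_scalars ::
  "('r, 'a, 'z) module_scheme \<Rightarrow> ('a, 'm, 'x) module_scheme \<Rightarrow> ('r, 'm) module"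
  where "restrict_scalars A M = \<lparr>carrier = carrier M, monoid.mult = monoid.mult M, one = one M,
    ring.zero = ring.zero M, add = add M, smult = (\<lambda>r x. (r \<odot>\<^bsub>A\<^esub> \<one>\<^bsub>A\<^esub>) \<odot>\<^bsub>M\<^esub> x)\<rparr>"


section \<open>Gradings\<close>

text \<open>\<open>D\<close> restricted to \<open>carrier \<Gamma>\<close> is a family of \<open>R\<close>-submodules of \<open>M\<close>, and \<open>M\<close> is their
  internal direct sum: every element is in a unique way a sum of a finitely supported family
  of elements \<open>c \<gamma> \<in> D \<gamma>\<close>.\<close>

definition direct_sum_decomposition ::
  "('r, 'z) ring_scheme \<Rightarrow> ('g, 'w) monoid_scheme \<Rightarrow> ('r, 'm, 'x) module_scheme \<Rightarrow> ('g \<Rightarrow> 'm set) \<Rightarrow> bool"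
  where "direct_sum_decomposition R \<Gamma> M D \<longleftrightarrow>
    (\<forall>\<gamma> \<in> carrier \<Gamma>. submodule (D \<gamma>) R M) \<and>
    (\<forall>x \<in> carrier M. \<exists>!c :: 'g \<Rightarrow> 'm.
        (\<forall>\<gamma> \<in> carrier \<Gamma>. c \<gamma> \<in> D \<gamma>) \<and> (\<forall>\<gamma>. \<gamma> \<notin> carrier \<Gamma> \<longrightarrow> c \<gamma> = \<zero>\<^bsub>M\<^esub>) \<and>
        finite {\<gamma>. c \<gamma> \<noteq> \<zero>\<^bsub>M\<^esub>} \<and> x = (\<Oplus>\<^bsub>M\<^esub>\<gamma> \<in> {\<gamma>. c \<gamma> \<noteq> \<zero>\<^bsub>M\<^esub>}. c \<gamma>))"

record ('s, 'm, 'g) graded = "('s, 'm) module" +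
  grade :: "'g \<Rightarrow> 'm set"

definition forget_grading :: "('s, 'm, 'g, 'x) graded_scheme \<Rightarrow> ('s, 'm) module"
  where "forget_grading M = module.truncate M"

definition supp :: "('g, 'w) monoid_scheme \<Rightarrow> ('s, 'm, 'g, 'x) graded_scheme \<Rightarrow> 'g set"
  where "supp \<Gamma> M = {\<gamma> \<in> carrier \<Gamma>. grade M \<gamma> \<noteq> {\<zero>\<^bsub>M\<^esub>}}"

locale graded_algebra = monoid \<Gamma> + assoc_algebra R A
  for R :: "('r, 'z) ring_scheme" and \<Gamma> :: "('g, 'w) monoid_scheme"
    and A :: "('r, 'a, 'g, 'x) graded_scheme" +
  assumes decomposition: "direct_sum_decomposition R \<Gamma> A (grade A)"
    and grade_mult: "\<lbrakk>\<gamma>\<^sub>1 \<in> carrier \<Gamma>; \<gamma>\<^sub>2 \<in> carrier \<Gamma>; a \<in> grade A \<gamma>\<^sub>1; b \<in> grade A \<gamma>\<^sub>2\<rbrakk> \<Longrightarrow>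
      a \<otimes>\<^bsub>A\<^esub> b \<in> grade A (\<gamma>\<^sub>1 \<otimes>\<^bsub>\<Gamma>\<^esub> \<gamma>\<^sub>2)"
    and grade_one: "\<one>\<^bsub>A\<^esub> \<in> grade A \<one>\<^bsub>\<Gamma>\<^esub>"

locale graded_left_module = left_module A M
  for R :: "('r, 'z) ring_scheme" and \<Gamma> :: "('g, 'w) monoid_scheme"
    and A :: "('r, 'a, 'g, 'x) graded_scheme" and M :: "('a, 'm, 'g, 'y) graded_scheme" +
  assumes decomposition: "direct_sum_decomposition R \<Gamma> (restrict_scalars A M) (grade M)"
    and grade_smult: "\<lbrakk>\<gamma>\<^sub>1 \<in> carrier \<Gamma>; \<gamma>\<^sub>2 \<in> carrier \<Gamma>; a \<in> grade A \<gamma>\<^sub>1; x \<in> grade M \<gamma>\<^sub>2\<rbrakk> \<Longrightarrow>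
      a \<odot>\<^bsub>M\<^esub> x \<in> grade M (\<gamma>\<^sub>1 \<otimes>\<^bsub>\<Gamma>\<^esub> \<gamma>\<^sub>2)"

definition graded_hom ::
  "('g, 'w) monoid_scheme \<Rightarrow> ('r, 'a, 'g, 'x) graded_scheme \<Rightarrow> ('a, 'm, 'g, 'y) graded_scheme \<Rightarrow>
    ('a, 'n, 'g, 'z) graded_scheme \<Rightarrow> ('m \<Rightarrow> 'n) set"
  where "graded_hom \<Gamma> A M N =
    {f \<in> left_module_hom A M N. \<forall>\<gamma> \<in> carrier \<Gamma>. f ` grade M \<gamma> \<subseteq> grade N \<gamma>}"

text \<open>Subobjects in the category of graded modules: submodules that are graded modules for the
  induced grading.\<close>

definition graded_submodule ::
  "('r, 'z) ring_scheme \<Rightarrow> ('g, 'w) monoid_scheme \<Rightarrow> ('r, 'a, 'g, 'x) graded_scheme \<Rightarrow>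
    ('a, 'm, 'g, 'y) graded_scheme \<Rightarrow> 'm set \<Rightarrow> bool"
  where "graded_submodule R \<Gamma> A M N \<longleftrightarrow> submodule N A M \<and>
    graded_left_module R \<Gamma> A (M\<lparr>carrier := N, grade := (\<lambda>\<gamma>. N \<inter> grade M \<gamma>)\<rparr>)"


section \<open>Superfluous subobjects and projective objects\<close>

text \<open>The first argument is the predicate singling out the subobjects of \<open>M\<close> in the category under
  consideration.\<close>

definition superfluous :: "('m set \<Rightarrow> bool) \<Rightarrow> ('m, 'x) ring_scheme \<Rightarrow> 'm set \<Rightarrow> bool"
  where "superfluous Sub M N \<longleftrightarrow> Sub N \<and>
    (\<forall>T. Sub T \<and> N <+>\<^bsub>M\<^esub> T = carrier M \<longrightarrow> T = carrier M)"

text \<open>Projectivity is the lifting property against surjective homomorphisms \<open>g : X \<rightarrow> Y\<close>.  A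
  formula cannot quantify over types, so the type of the elements of \<open>X\<close> and \<open>Y\<close> is a
  parameter \<open>'t\<close>.

  With \<open>'t\<close> a free type variable in a conclusion, the lifting property is asserted for all
  modules whatsoever.  In a hypothesis on a module \<open>P\<close> with elements in \<open>'m\<close> it is enough to
  take \<open>'t = 'm \<Rightarrow> 'a\<close>: this type contains a copy of \<open>P\<close> and of the free (graded) module on the
  (nonzero homogeneous) elements of \<open>P\<close>, realised as finitely supported functions from \<open>P\<close> to
  \<open>A\<close>.  Lifting the identity of \<open>P\<close> along the canonical surjection makes \<open>P\<close> a direct summand of
  a free (graded) module, which gives the lifting property for every other type.\<close>

definition projective_module ::
  "'t itself \<Rightarrow> ('a, 'z) ring_scheme \<Rightarrow> ('a, 'm, 'x) module_scheme \<Rightarrow> bool"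
  where "projective_module (_ :: 't itself) A P \<longleftrightarrow> left_module A P \<and>
    (\<forall>(X :: ('a, 't) module) (Y :: ('a, 't) module) g f.
        left_module A X \<and> left_module A Y \<and> g \<in> left_module_hom A X Y \<and>
        g ` carrier X = carrier Y \<and> f \<in> left_module_hom A P Y \<longrightarrow>
        (\<exists>h \<in> left_module_hom A P X. \<forall>p \<in> carrier P. g (h p) = f p))"

definition projective_graded_module ::
  "'t itself \<Rightarrow> ('r, 'z) ring_scheme \<Rightarrow> ('g, 'w) monoid_scheme \<Rightarrow> ('r, 'a, 'g, 'x) graded_scheme \<Rightarrow>
    ('a, 'm, 'g, 'y) graded_scheme \<Rightarrow> bool"
  where "projective_graded_module (_ :: 't itself) R \<Gamma> A P \<longleftrightarrow> graded_left_module R \<Gamma> A P \<and>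
    (\<forall>(X :: ('a, 't, 'g) graded) (Y :: ('a, 't, 'g) graded) g f.
        graded_left_module R \<Gamma> A X \<and> graded_left_module R \<Gamma> A Y \<and> g \<in> graded_hom \<Gamma> A X Y \<and>
        g ` carrier X = carrier Y \<and> f \<in> graded_hom \<Gamma> A P Y \<longrightarrow>
        (\<exists>h \<in> graded_hom \<Gamma> A P X. \<forall>p \<in> carrier P. g (h p) = f p))"


section \<open>Minimal projective resolutions\<close>

text \<open>A resolution is indexed by the integers \<open>k \<ge> -1\<close>, with \<open>P (-1) = M\<close> and
  \<open>d k : P (k + 1) \<rightarrow> P k\<close>; the values of \<open>P\<close> and \<open>d\<close> at \<open>k < -1\<close> are irrelevant.\<close>

definition exact_complex ::
  "(int \<Rightarrow> ('m, 'x) ring_scheme) \<Rightarrow> (int \<Rightarrow> 'm \<Rightarrow> 'm) \<Rightarrow> bool"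
  where "exact_complex P d \<longleftrightarrow>
    d (-1) ` carrier (P 0) = carrier (P (-1)) \<and>
    (\<forall>k \<ge> -1. d (k + 1) ` carrier (P (k + 2)) = a_kernel (P (k + 1)) (P k) (d k))"

definition projective_resolution ::
  "'t itself \<Rightarrow> ('a, 'z) ring_scheme \<Rightarrow> ('a, 'm, 'x) module_scheme \<Rightarrow>
    (int \<Rightarrow> ('a, 'm, 'x) module_scheme) \<Rightarrow> (int \<Rightarrow> 'm \<Rightarrow> 'm) \<Rightarrow> bool"
  where "projective_resolution T A M P d \<longleftrightarrow>
    P (-1) = M \<and>
    (\<forall>k \<ge> -1. left_module A (P k)) \<and>
    (\<forall>k \<ge> -1. d k \<in> left_module_hom A (P (k + 1)) (P k)) \<and>
    exact_complex P d \<and>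
    (\<forall>k \<ge> 0. projective_module T A (P k))"

definition minimal_projective_resolution ::
  "'t itself \<Rightarrow> ('a, 'z) ring_scheme \<Rightarrow> ('a, 'm, 'x) module_scheme \<Rightarrow>
    (int \<Rightarrow> ('a, 'm, 'x) module_scheme) \<Rightarrow> (int \<Rightarrow> 'm \<Rightarrow> 'm) \<Rightarrow> bool"
  where "minimal_projective_resolution T A M P d \<longleftrightarrow>
    projective_resolution T A M P d \<and>
    (\<forall>k \<ge> -1. superfluous (\<lambda>N. submodule N A (P (k + 1))) (P (k + 1))
        (a_kernel (P (k + 1)) (P k) (d k)))"

definition graded_projective_resolution ::
  "'t itself \<Rightarrow> ('r, 'z) ring_scheme \<Rightarrow> ('g, 'w) monoid_scheme \<Rightarrow> ('r, 'a, 'g, 'x) graded_scheme \<Rightarrow>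
    ('a, 'm, 'g, 'y) graded_scheme \<Rightarrow> (int \<Rightarrow> ('a, 'm, 'g, 'y) graded_scheme) \<Rightarrow>
    (int \<Rightarrow> 'm \<Rightarrow> 'm) \<Rightarrow> bool"
  where "graded_projective_resolution T R \<Gamma> A M P d \<longleftrightarrow>
    P (-1) = M \<and>
    (\<forall>k \<ge> -1. graded_left_module R \<Gamma> A (P k)) \<and>
    (\<forall>k \<ge> -1. d k \<in> graded_hom \<Gamma> A (P (k + 1)) (P k)) \<and>
    exact_complex P d \<and>
    (\<forall>k \<ge> 0. projective_graded_module T R \<Gamma> A (P k))"

definition minimal_graded_projective_resolution ::
  "'t itself \<Rightarrow> ('r, 'z) ring_scheme \<Rightarrow> ('g, 'w) monoid_scheme \<Rightarrow> ('r, 'a, 'g, 'x) graded_scheme \<Rightarrow>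
    ('a, 'm, 'g, 'y) graded_scheme \<Rightarrow> (int \<Rightarrow> ('a, 'm, 'g, 'y) graded_scheme) \<Rightarrow>
    (int \<Rightarrow> 'm \<Rightarrow> 'm) \<Rightarrow> bool"
  where "minimal_graded_projective_resolution T R \<Gamma> A M P d \<longleftrightarrow>
    graded_projective_resolution T R \<Gamma> A M P d \<and>
    (\<forall>k \<ge> -1. superfluous (graded_submodule R \<Gamma> A (P (k + 1))) (P (k + 1))
        (a_kernel (P (k + 1)) (P k) (d k)))"

end

theory Submission
  imports Defs
begin

text \<open>Exactness and the module structure do not involve the grading, so two things have to be
  shown: that the modules \<open>P k\<close> are projective as ungraded modules, and that the kernels remain
  superfluous when they are tested against arbitrary submodules.

  A projective graded module is a graded direct summand of a free graded module on homogeneous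
  generators (\<open>projective_graded_splits\<close>).  This remains true after forgetting the grading, and
  a summand of a free module is projective (\<open>projective_forget_grading\<close>).

  For the kernels, the finiteness of the supports is essential.  Each \<open>P k\<close> has finite support:
  a superfluous kernel forces \<open>P (k + 1)\<close> to be generated in degrees from the support of
  \<open>P k\<close>, and \<open>A\<close> contributes only finitely many further factors
  (\<open>finite_supp_of_superfluous_kernel\<close>).  Now let \<open>K\<close> be a superfluous graded submodule of a
  graded module \<open>M\<close> with finite support, and \<open>T\<close> an arbitrary submodule with
  \<open>K + T = M\<close>.  Let \<open>A\<^sub>+\<close> be the part of \<open>A\<close> in degrees other than \<open>e\<close>.  As \<open>e\<close> is
  the least element of \<open>\<Gamma>\<close> and multiplication is strictly monotone, \<open>A\<^sub>+\<close> strictly raises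
  degrees.  The quotient \<open>M/A\<^sub>+ M\<close> is a module over the degree \<open>e\<close> part of \<open>A\<close> alone, so its
  homogeneous components are submodules, the image of each component of \<open>K\<close> is superfluous in the
  corresponding component of the quotient with respect to all submodules, and finite sums of superfluous submodules
  are superfluous.  Hence \<open>T + A\<^sub>+ M = M\<close> (\<open>absorb_degrees\<close>).  Since \<open>A\<^sub>+\<close> acts
  nilpotently on a module with finite support, \<open>T = M\<close> follows as in Nakayama's lemma
  (\<open>graded_nakayama\<close>).\<close>

section \<open>Additive spans and projections of a grading\<close>

text \<open>Sums of finitely many members of \<open>S\<close>, presented as a closure so that statements about
homogeneous elements extend to all elements by induction, without manipulating finite sums.  There
is no clause for negatives: over a ring they come from the action of \<open>-1\<close>.\<close>
inductive_set add_span :: "('m, 'x) ring_scheme \<Rightarrow> 'm set \<Rightarrow> 'm set"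
  for M (structure) and S where
  zero: "\<zero> \<in> add_span M S"
| add: "s \<in> S \<Longrightarrow> x \<in> add_span M S \<Longrightarrow> s \<oplus> x \<in> add_span M S"

lemma add_span_least:
  assumes "S \<subseteq> N" "\<zero>\<^bsub>M\<^esub> \<in> N" "\<And>x y. x \<in> N \<Longrightarrow> y \<in> N \<Longrightarrow> x \<oplus>\<^bsub>M\<^esub> y \<in> N"
  shows "add_span M S \<subseteq> N"
proof
  fix x assume "x \<in> add_span M S"
  then show "x \<in> N" by induction (use assms in auto)
qed

context abelian_monoid
begin

lemma add_span_closed:
  assumes "S \<subseteq> carrier G" shows "add_span G S \<subseteq> carrier G"
  using assms by (intro add_span_least) auto

lemma add_span_incl:
  assumes "S \<subseteq> carrier G" shows "S \<subseteq> add_span G S"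
proof
  fix s assume s: "s \<in> S"
  have "s \<oplus> \<zero> \<in> add_span G S" using s by (intro add_span.intros)
  then show "s \<in> add_span G S" using s assms by auto
qed

lemma add_span_add:
  assumes S: "S \<subseteq> carrier G" and x: "x \<in> add_span G S" and y: "y \<in> add_span G S"
  shows "x \<oplus> y \<in> add_span G S"
  using x
proof induction
  case zero
  then show ?case using y add_span_closed[OF S] by auto
next
  case (add s x)
  moreover have "(s \<oplus> x) \<oplus> y = s \<oplus> (x \<oplus> y)"
    using add y S add_span_closed[OF S] by (intro a_assoc) auto
  ultimately show ?case by (auto intro: add_span.add)
qed

lemma add_span_mono:
  assumes "S \<subseteq> T" "T \<subseteq> carrier G" shows "add_span G S \<subseteq> add_span G T"
  using assms add_span_incl[of T] by (intro add_span_least add_span_add add_span.zero) auto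

lemma finsum_in:
  assumes "N \<subseteq> carrier G" "\<zero> \<in> N" "\<And>x y. x \<in> N \<Longrightarrow> y \<in> N \<Longrightarrow> x \<oplus> y \<in> N"
    and "finite F" "\<And>i. i \<in> F \<Longrightarrow> c i \<in> N"
  shows "finsum G c F \<in> N"
  using assms(4,5)
proof (induction F rule: finite_induct)
  case empty
  then show ?case using assms by simp
next
  case (insert i F)
  have "c \<in> F \<rightarrow> carrier G" "c i \<in> carrier G" using insert.prems assms(1) by auto
  then show ?case using insert assms(3) by (simp add: finsum_insert)
qed

text \<open>Sums of elements with different supports are compared by enlarging the index sets to a common
finite superset.\<close>
lemma finsum_superset:
  assumes "finite F" "E \<subseteq> F" "\<And>i. i \<in> F - E \<Longrightarrow> c i = \<zero>" "c \<in> F \<rightarrow> carrier G"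
  shows "finsum G c E = finsum G c F"
  using assms by (intro add.finprod_mono_neutral_cong_left) auto

end

lemma finsum_hom:
  assumes "abelian_monoid M" "abelian_monoid N"
    and "f \<in> carrier M \<rightarrow> carrier N" "f \<zero>\<^bsub>M\<^esub> = \<zero>\<^bsub>N\<^esub>"
    and "\<And>x y. x \<in> carrier M \<Longrightarrow> y \<in> carrier M \<Longrightarrow> f (x \<oplus>\<^bsub>M\<^esub> y) = f x \<oplus>\<^bsub>N\<^esub> f y"
    and "finite F" "c \<in> F \<rightarrow> carrier M"
  shows "f (finsum M c F) = finsum N (\<lambda>i. f (c i)) F"
proof -
  interpret M: abelian_monoid M by fact
  interpret N: abelian_monoid N by fact
  show ?thesis using assms(6,7)
  proof (induction F rule: finite_induct)
    case empty
    then show ?case using assms by simp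
  next
    case (insert i F)
    then have "c i \<in> carrier M" "finsum M c F \<in> carrier M" "c \<in> F \<rightarrow> carrier M"
      "(\<lambda>i. f (c i)) \<in> F \<rightarrow> carrier N" "f (c i) \<in> carrier N" using assms(3) by auto
    then show ?case using insert assms(5) by (simp add: M.finsum_insert N.finsum_insert)
  qed
qed

text \<open>The grading of a module is stated for its restriction of scalars to \<open>R\<close>, a different record
with the same additive structure.\<close>
lemma finsum_cong_record:
  assumes "carrier M = carrier N" "add M = add N" "\<zero>\<^bsub>M\<^esub> = \<zero>\<^bsub>N\<^esub>"
  shows "finsum M c F = finsum N c F"
  using assms by (simp add: finsum_def finprod_def)

text \<open>A direct sum in terms of its projections: the \<open>D i\<close> generate \<open>M\<close>, and for each \<open>i\<close>
there is an additive map that is the identity on \<open>D i\<close> and kills the other \<open>D j\<close>.  This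
amounts to existence and uniqueness of decompositions, but it contains no sums and so passes easily to
submodules, to isomorphic copies and to function modules.\<close>
locale direct_sum_projections = abelian_group M for I :: "'i set" and M (structure) +
  fixes D :: "'i \<Rightarrow> 'b set" and pr :: "'i \<Rightarrow> 'b \<Rightarrow> 'b"
  assumes D_carrier: "i \<in> I \<Longrightarrow> D i \<subseteq> carrier M"
    and D_zero: "i \<in> I \<Longrightarrow> \<zero> \<in> D i"
    and D_add: "i \<in> I \<Longrightarrow> x \<in> D i \<Longrightarrow> y \<in> D i \<Longrightarrow> x \<oplus> y \<in> D i"
    and pr_add: "i \<in> I \<Longrightarrow> x \<in> carrier M \<Longrightarrow> y \<in> carrier M \<Longrightarrow> pr i (x \<oplus> y) = pr i x \<oplus> pr i y"
    and pr_same: "i \<in> I \<Longrightarrow> x \<in> D i \<Longrightarrow> pr i x = x"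
    and pr_other: "i \<in> I \<Longrightarrow> j \<in> I \<Longrightarrow> i \<noteq> j \<Longrightarrow> x \<in> D j \<Longrightarrow> pr i x = \<zero>"
    and spanned: "carrier M \<subseteq> add_span M (\<Union>i\<in>I. D i)"
begin

lemma D_union: "(\<Union>i\<in>I. D i) \<subseteq> carrier M" using D_carrier by auto

lemma D_carrierI: "i \<in> I \<Longrightarrow> x \<in> D i \<Longrightarrow> x \<in> carrier M" using D_carrier by auto

lemma carrier_induct [consumes 1, case_names zero add]:
  assumes "x \<in> carrier M"
    and "P \<zero>"
    and "\<And>i s x. i \<in> I \<Longrightarrow> s \<in> D i \<Longrightarrow> x \<in> carrier M \<Longrightarrow> P x \<Longrightarrow> P (s \<oplus> x)"
  shows "P x"
proof -
  have "x \<in> add_span M (\<Union>i\<in>I. D i)" using assms spanned by auto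
  then show ?thesis
  proof induction
    case zero
    show ?case by fact
  next
    case (add s x)
    then show ?case using assms(3) add_span_closed[OF D_union] by auto
  qed
qed

lemma pr_zero: "i \<in> I \<Longrightarrow> pr i \<zero> = \<zero>"
  using pr_same D_zero by blast

lemma pr_in:
  assumes i: "i \<in> I" and x: "x \<in> carrier M"
  shows "pr i x \<in> D i"
  using x
proof (induction rule: carrier_induct)
  case zero
  then show ?case using i by (simp add: pr_zero D_zero)
next
  case (add j s x)
  have "pr i s \<in> D i" using add i by (cases "i = j") (auto simp: pr_same pr_other D_zero)
  then show ?case using add i D_carrierI by (simp add: pr_add D_add)
qed

lemma pr_carrier: "i \<in> I \<Longrightarrow> x \<in> carrier M \<Longrightarrow> pr i x \<in> carrier M"
  using pr_in D_carrierI by blast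

text \<open>Only finitely many projections of \<open>x\<close> are nonzero, and they add up to \<open>x\<close>.  Both claims
are proved together because the induction on \<open>x\<close> as a sum of homogeneous elements enlarges
the index set by the degree of each new summand.\<close>
lemma sum_of_projections:
  assumes "x \<in> carrier M"
  shows "\<exists>F\<subseteq>I. finite F \<and> (\<forall>i\<in>I - F. pr i x = \<zero>) \<and> x = finsum M (\<lambda>i. pr i x) F"
  using assms
proof (induction rule: carrier_induct)
  case zero
  show ?case by (rule exI[of _ "{}"]) (auto simp: pr_zero)
next
  case (add j s x)
  then obtain F where F: "F \<subseteq> I" "finite F" "\<And>i. i \<in> I - F \<Longrightarrow> pr i x = \<zero>"
    and x: "x = finsum M (\<lambda>i. pr i x) F" by auto
  let ?F = "insert j F"
  have s: "s \<in> carrier M" using add D_carrierI by auto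
  have FI: "?F \<subseteq> I" using F add by auto
  have c: "(\<lambda>i. pr i x) \<in> ?F \<rightarrow> carrier M" "(\<lambda>i. pr i s) \<in> ?F \<rightarrow> carrier M"
    using FI add s by (auto intro!: pr_carrier)
  have "finsum M (\<lambda>i. pr i (s \<oplus> x)) ?F = finsum M (\<lambda>i. pr i s \<oplus> pr i x) ?F"
    using FI add s c by (intro finsum_cong') (auto simp: pr_add)
  also have "\<dots> = finsum M (\<lambda>i. pr i s) ?F \<oplus> finsum M (\<lambda>i. pr i x) ?F"
    using c by (rule finsum_addf[rotated])
  also have "finsum M (\<lambda>i. pr i x) ?F = x"
  proof -
    have "finsum M (\<lambda>i. pr i x) F = finsum M (\<lambda>i. pr i x) ?F"
      using c F add by (intro finsum_superset) auto
    then show ?thesis using x by simp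
  qed
  also have "finsum M (\<lambda>i. pr i s) ?F = finsum M (\<lambda>i. pr i s) {j}"
    using c F add FI by (intro finsum_superset[symmetric]) (auto intro: pr_other)
  also have "\<dots> = s" using add s by (simp add: finsum_insert pr_same)
  finally have "finsum M (\<lambda>i. pr i (s \<oplus> x)) ?F = s \<oplus> x" .
  moreover have "pr i (s \<oplus> x) = \<zero>" if "i \<in> I - ?F" for i
    using that add F s by (auto simp: pr_add pr_other[of i j])
  ultimately show ?case using FI F(2) by (intro exI[of _ ?F]) auto
qed

lemma finite_support:
  assumes "x \<in> carrier M" shows "finite {i \<in> I. pr i x \<noteq> \<zero>}"
proof -
  obtain F where "finite F" "\<forall>i\<in>I - F. pr i x = \<zero>" using sum_of_projections[OF assms] by auto
  then show ?thesis by (elim finite_subset[rotated]) auto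
qed

lemma sum_over_support:
  assumes "x \<in> carrier M" shows "finsum M (\<lambda>i. pr i x) {i \<in> I. pr i x \<noteq> \<zero>} = x"
proof -
  obtain F where F: "F \<subseteq> I" "finite F" "\<forall>i\<in>I - F. pr i x = \<zero>" "x = finsum M (\<lambda>i. pr i x) F"
    using sum_of_projections[OF assms] by auto
  have "finsum M (\<lambda>i. pr i x) {i \<in> I. pr i x \<noteq> \<zero>} = finsum M (\<lambda>i. pr i x) F"
    using F assms by (intro finsum_superset) (auto intro!: pr_carrier)
  then show ?thesis using F by simp
qed

lemma unique_decomposition:
  assumes x: "x \<in> carrier M"
  shows "\<exists>!c. (\<forall>i \<in> I. c i \<in> D i) \<and> (\<forall>i. i \<notin> I \<longrightarrow> c i = \<zero>) \<and>
        finite {i. c i \<noteq> \<zero>} \<and> x = finsum M c {i. c i \<noteq> \<zero>}" (is "\<exists>!c. ?Q c")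
proof (rule ex1I[of _ "\<lambda>i. if i \<in> I then pr i x else \<zero>"])
  let ?c = "\<lambda>i. if i \<in> I then pr i x else \<zero>"
  have eq: "{i. ?c i \<noteq> \<zero>} = {i \<in> I. pr i x \<noteq> \<zero>}" by auto
  have "finsum M ?c {i \<in> I. pr i x \<noteq> \<zero>} = finsum M (\<lambda>i. pr i x) {i \<in> I. pr i x \<noteq> \<zero>}"
    using x by (intro finsum_cong') (auto intro: pr_carrier)
  then show "?Q ?c"
    unfolding eq using sum_over_support finite_support x pr_in by auto
next
  fix c assume c: "?Q c"
  \<comment> \<open>Apply the projection \<open>pr i\<close> to the sum of the \<open>c j\<close>.\<close>
  show "c = (\<lambda>i. if i \<in> I then pr i x else \<zero>)"
  proof
    fix i
    show "c i = (if i \<in> I then pr i x else \<zero>)"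
    proof (cases "i \<in> I")
      case True
      let ?S = "{i. c i \<noteq> \<zero>}"
      have S: "?S \<subseteq> I" using c by auto
      have cc: "c \<in> UNIV \<rightarrow> carrier M" using c D_carrierI by (metis Pi_I zero_closed)
      have "pr i x = finsum M (\<lambda>j. pr i (c j)) ?S"
        using c True cc finsum_hom[OF abelian_monoid_axioms abelian_monoid_axioms, of "pr i" ?S c]
        by (auto simp: pr_zero pr_add pr_carrier)
      also have "\<dots> = finsum M (\<lambda>j. pr i (c j)) (insert i ?S)"
        using c True cc by (intro finsum_superset) (auto intro!: pr_carrier simp: pr_zero)
      also have "\<dots> = finsum M (\<lambda>j. pr i (c j)) {i}"
        using c True cc by (intro finsum_superset[symmetric])
           (auto intro!: pr_carrier simp: pr_zero intro: pr_other)
      also have "\<dots> = c i" using True c cc by (simp add: finsum_insert pr_same Pi_iff)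
      finally show ?thesis using True by simp
    qed (use c in auto)
  qed
qed

end

text \<open>Conversely, sending \<open>x\<close> to its \<open>i\<close>-th component is additive, because the componentwise
sum of the families of \<open>x\<close> and \<open>y\<close> is a decomposition of \<open>x \<oplus> y\<close>, hence the only
one.\<close>
lemma projections_of_unique_decomposition:
  fixes M (structure)
  assumes "abelian_group M"
    and D: "\<And>i. i \<in> I \<Longrightarrow> D i \<subseteq> carrier M" "\<And>i. i \<in> I \<Longrightarrow> \<zero> \<in> D i"
      "\<And>i x y. i \<in> I \<Longrightarrow> x \<in> D i \<Longrightarrow> y \<in> D i \<Longrightarrow> x \<oplus> y \<in> D i"
    and ex1: "\<And>x. x \<in> carrier M \<Longrightarrow>
      \<exists>!c. (\<forall>i \<in> I. c i \<in> D i) \<and> (\<forall>i. i \<notin> I \<longrightarrow> c i = \<zero>) \<and>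
        finite {i. c i \<noteq> \<zero>} \<and> x = finsum M c {i. c i \<noteq> \<zero>}"
  shows "\<exists>pr. direct_sum_projections I M D pr"
proof -
  interpret abelian_group M by fact
  let ?Q = "\<lambda>x c. (\<forall>i \<in> I. c i \<in> D i) \<and> (\<forall>i. i \<notin> I \<longrightarrow> c i = \<zero>) \<and>
        finite {i. c i \<noteq> \<zero>} \<and> x = finsum M c {i. c i \<noteq> \<zero>}"
  define comp where "comp x = (THE c. ?Q x c)" for x
  have comp: "?Q x (comp x)" if "x \<in> carrier M" for x
    unfolding comp_def using ex1[OF that] by (rule theI')
  have comp_eq: "comp x = c" if "x \<in> carrier M" "?Q x c" for x c
    using ex1[OF that(1)] comp[OF that(1)] that(2) by blast
  have comp_carrier: "comp x i \<in> carrier M" if "x \<in> carrier M" for x i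
    using comp[OF that] D(1) by (metis subsetD zero_closed)
  have comp_sum: "comp (x \<oplus> y) = (\<lambda>i. comp x i \<oplus> comp y i)"
    if x: "x \<in> carrier M" and y: "y \<in> carrier M" for x y
  proof (rule comp_eq)
    let ?F = "{i. comp x i \<noteq> \<zero>} \<union> {i. comp y i \<noteq> \<zero>}"
    let ?s = "\<lambda>i. comp x i \<oplus> comp y i"
    have F: "finite ?F" "{i. ?s i \<noteq> \<zero>} \<subseteq> ?F" using comp x y by auto
    have "finsum M ?s {i. ?s i \<noteq> \<zero>} = finsum M ?s ?F"
      using F comp_carrier x y by (intro finsum_superset) auto
    also have "\<dots> = finsum M (comp x) ?F \<oplus> finsum M (comp y) ?F"
      using comp_carrier x y by (intro finsum_addf) auto
    also have "finsum M (comp x) ?F = finsum M (comp x) {i. comp x i \<noteq> \<zero>}"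
      using F comp_carrier x by (intro finsum_superset[symmetric]) auto
    also have "\<dots> = x" using comp[OF x] by simp
    also have "finsum M (comp y) ?F = finsum M (comp y) {i. comp y i \<noteq> \<zero>}"
      using F comp_carrier y by (intro finsum_superset[symmetric]) auto
    also have "\<dots> = y" using comp[OF y] by simp
    finally show "?Q (x \<oplus> y) ?s"
      using comp[OF x] comp[OF y] F finite_subset[OF F(2,1)] D(3) by auto
  qed (use that in auto)
  have comp_hom: "comp x = (\<lambda>i. if i = j then x else \<zero>)" if "j \<in> I" "x \<in> D j" for x j
  proof (rule comp_eq)
    show x: "x \<in> carrier M" using that D by auto
    have "{i. (if i = j then x else \<zero>) \<noteq> \<zero>} = (if x = \<zero> then {} else {j})" by auto
    then show "?Q x (\<lambda>i. if i = j then x else \<zero>)"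
      using that D(2) x by (auto simp: finsum_insert)
  qed
  have "direct_sum_projections I M D (\<lambda>i x. comp x i)"
  proof
    show "carrier M \<subseteq> add_span M (\<Union>i\<in>I. D i)"
    proof
      fix x assume x: "x \<in> carrier M"
      have U: "(\<Union>i\<in>I. D i) \<subseteq> carrier M" using D by auto
      have "finsum M (comp x) {i. comp x i \<noteq> \<zero>} \<in> add_span M (\<Union>i\<in>I. D i)"
        using comp[OF x] add_span_incl[OF U]
        by (intro finsum_in add_span_closed U add_span.zero add_span_add) auto
      then show "x \<in> add_span M (\<Union>i\<in>I. D i)" using comp[OF x] by simp
    qed
  qed (use D comp_sum comp_hom in auto)
  then show ?thesis by blast
qed

text \<open>Collecting the components whose indices have the same image under \<open>\<theta>\<close> gives a direct sum
indexed by \<open>J\<close>.  It is used for \<open>\<theta> \<alpha> = \<alpha>\<delta>\<close>, which need not be injective: the order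
of \<open>\<Gamma>\<close> is only partial, so incomparable degrees may have the same product with
\<open>\<delta>\<close>.\<close>
lemma (in direct_sum_projections) coarsening:
  assumes \<theta>: "\<theta> \<in> I \<rightarrow> J"
  shows "\<exists>q. direct_sum_projections J M (\<lambda>j. add_span M (\<Union>i\<in>{i\<in>I. \<theta> i = j}. D i)) q"
proof -
  let ?E = "\<lambda>j. add_span M (\<Union>i\<in>{i\<in>I. \<theta> i = j}. D i)"
  define q where "q j x = finsum M (\<lambda>i. pr i x) {i \<in> I. pr i x \<noteq> \<zero> \<and> \<theta> i = j}" for j x
  have q: "q j x = finsum M (\<lambda>i. pr i x) {i \<in> F. \<theta> i = j}"
    if "x \<in> carrier M" "F \<subseteq> I" "finite F" "{i \<in> I. pr i x \<noteq> \<zero>} \<subseteq> F" for j x F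
    unfolding q_def using that by (intro finsum_superset) (auto intro: pr_carrier)
  have q_add: "q j (x \<oplus> y) = q j x \<oplus> q j y" if x: "x \<in> carrier M" and y: "y \<in> carrier M" for j x y
  proof -
    let ?F = "{i \<in> I. pr i x \<noteq> \<zero>} \<union> {i \<in> I. pr i y \<noteq> \<zero>}"
    have F: "finite ?F" "?F \<subseteq> I" using finite_support x y by auto
    have "q j (x \<oplus> y) = finsum M (\<lambda>i. pr i (x \<oplus> y)) {i \<in> ?F. \<theta> i = j}"
      using x y F by (intro q) (auto simp: pr_add)
    also have "\<dots> = finsum M (\<lambda>i. pr i x \<oplus> pr i y) {i \<in> ?F. \<theta> i = j}"
      using x y F by (intro finsum_cong') (auto simp: pr_add intro: pr_carrier)
    also have "\<dots> = finsum M (\<lambda>i. pr i x) {i \<in> ?F. \<theta> i = j} \<oplus> finsum M (\<lambda>i. pr i y) {i \<in> ?F. \<theta> i = j}"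
      using x y F by (intro finsum_addf) (auto intro: pr_carrier)
    also have "\<dots> = q j x \<oplus> q j y"
      using x y F q[of x ?F j] q[of y ?F j] by auto
    finally show ?thesis .
  qed
  have q_hom: "q j x = (if \<theta> i = j then x else \<zero>)" if "i \<in> I" "x \<in> D i" for i j x
  proof -
    have x: "x \<in> carrier M" using that D_carrierI by auto
    have "q j x = finsum M (\<lambda>i. pr i x) {k \<in> {i}. \<theta> k = j}"
      using that x by (intro q) (auto intro: pr_other ccontr)
    also have "{k \<in> {i}. \<theta> k = j} = (if \<theta> i = j then {i} else {})" by auto
    finally show ?thesis using that x by (auto simp: finsum_insert pr_same)
  qed
  have q0: "q j \<zero> = \<zero>" for j
  proof -
    have "{i \<in> I. pr i \<zero> \<noteq> \<zero> \<and> \<theta> i = j} = {}" by (auto simp: pr_zero)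
    then show ?thesis unfolding q_def by (simp only: finsum_empty)
  qed
  have sub: "(\<Union>i\<in>{i\<in>I. \<theta> i = j}. D i) \<subseteq> carrier M" for j using D_union by auto
  have q_E: "q k x = (if j = k then x else \<zero>)" if "x \<in> ?E j" for j k x
    using that
  proof induction
    case zero
    then show ?case by (simp add: q0)
  next
    case (add s x)
    then obtain i where i: "i \<in> I" "\<theta> i = j" "s \<in> D i" by auto
    moreover have "x \<in> carrier M" "s \<in> carrier M" using add add_span_closed[OF sub] i D_carrierI by auto
    ultimately show ?case using add q_hom[of i s k] by (auto simp: q_add)
  qed
  have "direct_sum_projections J M ?E q"
  proof
    show "?E j \<subseteq> carrier M" for j using add_span_closed[OF sub] .
    show "\<zero> \<in> ?E j" for j by (rule add_span.zero)
    show "x \<oplus> y \<in> ?E j" if "x \<in> ?E j" "y \<in> ?E j" for x y j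
      using sub that by (rule add_span_add)
    have "(\<Union>i\<in>I. D i) \<subseteq> (\<Union>j\<in>J. ?E j)"
    proof
      fix x assume "x \<in> (\<Union>i\<in>I. D i)"
      then obtain i where i: "i \<in> I" "x \<in> D i" by auto
      then have "x \<in> ?E (\<theta> i)" using add_span_incl[OF sub[of "\<theta> i"]] by auto
      then show "x \<in> (\<Union>j\<in>J. ?E j)" using i \<theta> by auto
    qed
    then have "add_span M (\<Union>i\<in>I. D i) \<subseteq> add_span M (\<Union>j\<in>J. ?E j)"
      using add_span_closed[OF sub] by (intro add_span_mono) auto
    then show "carrier M \<subseteq> add_span M (\<Union>j\<in>J. ?E j)" using spanned by auto
  qed (use q_add q_E in auto)
  then show ?thesis by blast
qed

section \<open>Left modules and graded left modules\<close>

lemma submodule_iff: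
  "submodule N R M \<longleftrightarrow> N \<subseteq> carrier M \<and> \<zero>\<^bsub>M\<^esub> \<in> N \<and> (\<forall>x\<in>N. \<forall>y\<in>N. x \<oplus>\<^bsub>M\<^esub> y \<in> N) \<and>
     (\<forall>x\<in>N. \<ominus>\<^bsub>M\<^esub> x \<in> N) \<and> (\<forall>r\<in>carrier R. \<forall>x\<in>N. r \<odot>\<^bsub>M\<^esub> x \<in> N)"
  unfolding submodule_def subgroup_def submodule_axioms_def a_inv_def by auto

context left_module
begin

lemma zero_smult:
  assumes x: "x \<in> carrier M" shows "\<zero>\<^bsub>A\<^esub> \<odot>\<^bsub>M\<^esub> x = \<zero>\<^bsub>M\<^esub>"
proof -
  have "\<zero>\<^bsub>A\<^esub> \<odot>\<^bsub>M\<^esub> x \<oplus>\<^bsub>M\<^esub> \<zero>\<^bsub>A\<^esub> \<odot>\<^bsub>M\<^esub> x = \<zero>\<^bsub>A\<^esub> \<odot>\<^bsub>M\<^esub> x"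
    using smult_l_distr[of "\<zero>\<^bsub>A\<^esub>" "\<zero>\<^bsub>A\<^esub>" x] x by simp
  then show ?thesis using M.add.l_cancel_one smult_closed[OF _ x] by auto
qed

lemma smult_zero:
  assumes a: "a \<in> carrier A" shows "a \<odot>\<^bsub>M\<^esub> \<zero>\<^bsub>M\<^esub> = \<zero>\<^bsub>M\<^esub>"
proof -
  have "a \<odot>\<^bsub>M\<^esub> \<zero>\<^bsub>M\<^esub> \<oplus>\<^bsub>M\<^esub> a \<odot>\<^bsub>M\<^esub> \<zero>\<^bsub>M\<^esub> = a \<odot>\<^bsub>M\<^esub> \<zero>\<^bsub>M\<^esub>"
    using smult_r_distr[of a "\<zero>\<^bsub>M\<^esub>" "\<zero>\<^bsub>M\<^esub>"] a by simp
  then show ?thesis using M.add.l_cancel_one smult_closed[OF a] by auto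
qed

lemma minus_one_smult:
  assumes x: "x \<in> carrier M" shows "(\<ominus>\<^bsub>A\<^esub> \<one>\<^bsub>A\<^esub>) \<odot>\<^bsub>M\<^esub> x = \<ominus>\<^bsub>M\<^esub> x"
proof -
  have "(\<ominus>\<^bsub>A\<^esub> \<one>\<^bsub>A\<^esub>) \<odot>\<^bsub>M\<^esub> x \<oplus>\<^bsub>M\<^esub> x = (\<ominus>\<^bsub>A\<^esub> \<one>\<^bsub>A\<^esub> \<oplus>\<^bsub>A\<^esub> \<one>\<^bsub>A\<^esub>) \<odot>\<^bsub>M\<^esub> x"
    using x by (subst smult_l_distr) (auto simp: smult_one)
  also have "\<dots> = \<zero>\<^bsub>M\<^esub>" using x by (simp add: A.l_neg zero_smult)
  finally show ?thesis using x smult_closed by (intro M.minus_equality[symmetric]) auto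
qed

lemma submoduleI:
  assumes N: "N \<subseteq> carrier M" "\<zero>\<^bsub>M\<^esub> \<in> N" "\<And>x y. x \<in> N \<Longrightarrow> y \<in> N \<Longrightarrow> x \<oplus>\<^bsub>M\<^esub> y \<in> N"
    "\<And>a x. a \<in> carrier A \<Longrightarrow> x \<in> N \<Longrightarrow> a \<odot>\<^bsub>M\<^esub> x \<in> N"
  shows "submodule N A M"
proof -
  have "\<ominus>\<^bsub>M\<^esub> x \<in> N" if "x \<in> N" for x
    using N(4)[of "\<ominus>\<^bsub>A\<^esub> \<one>\<^bsub>A\<^esub>" x] minus_one_smult[of x] N(1) that by auto
  then show ?thesis unfolding submodule_iff using N by auto
qed

lemma smult_add_span:
  assumes a: "a \<in> carrier A" and S: "S \<subseteq> carrier M" "T \<subseteq> carrier M"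
    and gen: "\<And>s. s \<in> S \<Longrightarrow> a \<odot>\<^bsub>M\<^esub> s \<in> add_span M T" and x: "x \<in> add_span M S"
  shows "a \<odot>\<^bsub>M\<^esub> x \<in> add_span M T"
  using x
proof induction
  case zero
  then show ?case using a by (simp add: smult_zero add_span.zero)
next
  case (add s x)
  then have "a \<odot>\<^bsub>M\<^esub> (s \<oplus>\<^bsub>M\<^esub> x) = a \<odot>\<^bsub>M\<^esub> s \<oplus>\<^bsub>M\<^esub> a \<odot>\<^bsub>M\<^esub> x"
    using a S M.add_span_closed[OF S(1)] by (intro smult_r_distr) auto
  then show ?case using add gen S by (auto intro: M.add_span_add)
qed

lemma left_module_submodule:
  assumes N: "submodule N A M"
    and M': "carrier M' = N" "add M' = add M" "\<zero>\<^bsub>M'\<^esub> = \<zero>\<^bsub>M\<^esub>" "smult M' = smult M"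
  shows "left_module A M'"
proof -
  have sub: "x \<in> carrier M" if "x \<in> N" for x using N that unfolding submodule_iff by auto
  have "abelian_group M'"
  proof (rule abelian_groupI)
    fix x assume "x \<in> carrier M'"
    then show "\<exists>y\<in>carrier M'. y \<oplus>\<^bsub>M'\<^esub> x = \<zero>\<^bsub>M'\<^esub>"
      using N M.l_neg[of x] sub[of x] unfolding M' submodule_iff by auto
  qed (use N sub M.a_assoc M.a_comm in \<open>auto simp: M' submodule_iff\<close>)
  then show ?thesis
    unfolding left_module_def left_module_axioms_def M'
    using N sub A.ring_axioms smult_l_distr smult_r_distr smult_assoc smult_one
    by (auto simp: submodule_iff)
qed

end

text \<open>Only the carriers and operations matter, so being a left module is insensitive to the grading
field of either record.\<close>
lemma left_module_cong:
  assumes M: "left_module A M"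
    and A': "carrier A' = carrier A" "add A' = add A" "\<zero>\<^bsub>A'\<^esub> = \<zero>\<^bsub>A\<^esub>" "monoid.mult A' = monoid.mult A"
      "\<one>\<^bsub>A'\<^esub> = \<one>\<^bsub>A\<^esub>"
    and M': "carrier M' = carrier M" "add M' = add M" "\<zero>\<^bsub>M'\<^esub> = \<zero>\<^bsub>M\<^esub>" "smult M' = smult M"
  shows "left_module A' M'"
proof -
  interpret left_module A M by fact
  have ab: "abelian_group A'"
  proof (rule abelian_groupI)
    fix x assume "x \<in> carrier A'"
    then show "\<exists>y\<in>carrier A'. y \<oplus>\<^bsub>A'\<^esub> x = \<zero>\<^bsub>A'\<^esub>"
      unfolding A' using A.l_neg A.a_inv_closed by blast
  qed (auto simp: A' A.a_assoc intro: A.a_comm)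
  have "monoid A'" using A.m_assoc by (intro monoidI) (auto simp: A')
  then have "ring A'" using ab by (intro ringI) (auto simp: A' A.l_distr A.r_distr)
  moreover have "abelian_group M'"
  proof (rule abelian_groupI)
    fix x assume "x \<in> carrier M'"
    then show "\<exists>y\<in>carrier M'. y \<oplus>\<^bsub>M'\<^esub> x = \<zero>\<^bsub>M'\<^esub>"
      unfolding M' using M.l_neg M.a_inv_closed by blast
  qed (auto simp: M' M.a_assoc intro: M.a_comm)
  ultimately show ?thesis
    unfolding left_module_def left_module_axioms_def M' A'
    using smult_closed smult_l_distr smult_r_distr smult_assoc smult_one by auto
qed

lemma left_module_hom_zero:
  assumes "left_module A M" "left_module A N" "f \<in> left_module_hom A M N"
  shows "f \<zero>\<^bsub>M\<^esub> = \<zero>\<^bsub>N\<^esub>"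
proof -
  interpret M: left_module A M by fact
  interpret N: left_module A N by fact
  have "f (\<zero>\<^bsub>A\<^esub> \<odot>\<^bsub>M\<^esub> \<zero>\<^bsub>M\<^esub>) = \<zero>\<^bsub>A\<^esub> \<odot>\<^bsub>N\<^esub> f \<zero>\<^bsub>M\<^esub>" "f \<zero>\<^bsub>M\<^esub> \<in> carrier N"
    using assms(3) unfolding left_module_hom_def by auto
  then show ?thesis by (simp add: M.zero_smult N.zero_smult)
qed

lemma add_span_cong:
  assumes "add M = add N" "\<zero>\<^bsub>M\<^esub> = \<zero>\<^bsub>N\<^esub>"
  shows "add_span M S = add_span N S"
proof -
  have "x \<in> add_span N S" if "x \<in> add_span M S" for x
    using that by induction (auto simp: assms intro: add_span.intros)
  moreover have "x \<in> add_span M S" if "x \<in> add_span N S" for x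
    using that by induction (auto simp flip: assms intro: add_span.intros)
  ultimately show ?thesis by auto
qed

context graded_algebra
begin

definition alg_proj :: "'g \<Rightarrow> 'a \<Rightarrow> 'a" where
  "alg_proj = (SOME pr. direct_sum_projections (carrier \<Gamma>) A (grade A) pr)"

lemma ex_alg_projections: "\<exists>pr. direct_sum_projections (carrier \<Gamma>) A (grade A) pr"
  using decomposition unfolding direct_sum_decomposition_def
  by (intro projections_of_unique_decomposition) (auto simp: submodule_iff is_abelian_group)

end

sublocale graded_algebra \<subseteq> gr: direct_sum_projections "carrier \<Gamma>" A "grade A" alg_proj
  unfolding alg_proj_def using ex_alg_projections by (rule someI_ex)

text \<open>In a graded algebra \<open>r \<in> R\<close> acts on a graded module as \<open>r \<cdot> 1\<close>, an element of degree
\<open>e\<close>, and likewise negation is the action of \<open>-1\<close>.  Hence the homogeneous components are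
\<open>R\<close>-submodules as soon as multiplication respects degrees.\<close>
lemma graded_left_moduleI:
  assumes alg: "graded_algebra R \<Gamma> A" and M: "left_module A M"
    and pr: "direct_sum_projections (carrier \<Gamma>) M (grade M) pr"
    and smult: "\<And>\<alpha> \<gamma> a x. \<lbrakk>\<alpha> \<in> carrier \<Gamma>; \<gamma> \<in> carrier \<Gamma>; a \<in> grade A \<alpha>; x \<in> grade M \<gamma>\<rbrakk> \<Longrightarrow>
      a \<odot>\<^bsub>M\<^esub> x \<in> grade M (\<alpha> \<otimes>\<^bsub>\<Gamma>\<^esub> \<gamma>)"
  shows "graded_left_module R \<Gamma> A M"
proof -
  interpret alg: graded_algebra R \<Gamma> A by fact
  interpret mod: left_module A M by fact
  interpret pr: direct_sum_projections "carrier \<Gamma>" M "grade M" pr by fact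
  have e: "submodule (grade A \<one>\<^bsub>\<Gamma>\<^esub>) R A"
    using alg.decomposition unfolding direct_sum_decomposition_def by auto
  have inv: "\<ominus>\<^bsub>restrict_scalars A M\<^esub> x = \<ominus>\<^bsub>M\<^esub> x" for x
    by (simp add: restrict_scalars_def a_inv_def m_inv_def)
  have "submodule (grade M \<gamma>) R (restrict_scalars A M)" if \<gamma>: "\<gamma> \<in> carrier \<Gamma>" for \<gamma>
  proof -
    have deg_e: "a \<odot>\<^bsub>M\<^esub> x \<in> grade M \<gamma>" if "a \<in> grade A \<one>\<^bsub>\<Gamma>\<^esub>" "x \<in> grade M \<gamma>" for a x
      using smult[of "\<one>\<^bsub>\<Gamma>\<^esub>" \<gamma> a x] that \<gamma> by simp
    have "\<ominus>\<^bsub>M\<^esub> x \<in> grade M \<gamma>" if "x \<in> grade M \<gamma>" for x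
      using deg_e[of "\<ominus>\<^bsub>A\<^esub> \<one>\<^bsub>A\<^esub>" x] mod.minus_one_smult[of x] e that alg.grade_one pr.D_carrierI[OF \<gamma>]
      by (auto simp: submodule_iff)
    then show ?thesis
      unfolding submodule_iff inv using pr.D_carrier pr.D_zero pr.D_add \<gamma> deg_e e alg.grade_one
      by (auto simp: restrict_scalars_def submodule_iff)
  qed
  moreover have "\<exists>!c. (\<forall>\<gamma> \<in> carrier \<Gamma>. c \<gamma> \<in> grade M \<gamma>) \<and>
        (\<forall>\<gamma>. \<gamma> \<notin> carrier \<Gamma> \<longrightarrow> c \<gamma> = \<zero>\<^bsub>restrict_scalars A M\<^esub>) \<and>
        finite {\<gamma>. c \<gamma> \<noteq> \<zero>\<^bsub>restrict_scalars A M\<^esub>} \<and>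
        x = finsum (restrict_scalars A M) c {\<gamma>. c \<gamma> \<noteq> \<zero>\<^bsub>restrict_scalars A M\<^esub>}"
    if "x \<in> carrier (restrict_scalars A M)" for x
  proof -
    have fs: "finsum (restrict_scalars A M) c F = finsum M c F" for c F
      by (rule finsum_cong_record) (auto simp: restrict_scalars_def)
    have "\<zero>\<^bsub>restrict_scalars A M\<^esub> = \<zero>\<^bsub>M\<^esub>" "carrier (restrict_scalars A M) = carrier M"
      by (auto simp: restrict_scalars_def)
    then show ?thesis using pr.unique_decomposition[of x] that unfolding fs by simp
  qed
  ultimately have "direct_sum_decomposition R \<Gamma> (restrict_scalars A M) (grade M)"
    unfolding direct_sum_decomposition_def by blast
  then show ?thesis
    using smult by (intro graded_left_module.intro graded_left_module_axioms.intro M) auto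
qed

locale graded_module = alg: graded_algebra R \<Gamma> A + mod: graded_left_module R \<Gamma> A M
  for R :: "('r, 'z) ring_scheme" and \<Gamma> :: "('g, 'w) monoid_scheme"
    and A :: "('r, 'a, 'g, 'x) graded_scheme" and M :: "('a, 'm, 'g, 'y) graded_scheme"
begin

definition proj :: "'g \<Rightarrow> 'm \<Rightarrow> 'm" where
  "proj = (SOME pr. direct_sum_projections (carrier \<Gamma>) M (grade M) pr)"

lemma ex_projections: "\<exists>pr. direct_sum_projections (carrier \<Gamma>) M (grade M) pr"
proof (rule projections_of_unique_decomposition)
  have sub: "submodule (grade M \<gamma>) R (restrict_scalars A M)" if "\<gamma> \<in> carrier \<Gamma>" for \<gamma>
    using mod.decomposition that unfolding direct_sum_decomposition_def by auto
  show "grade M \<gamma> \<subseteq> carrier M" "\<zero>\<^bsub>M\<^esub> \<in> grade M \<gamma>" if "\<gamma> \<in> carrier \<Gamma>" for \<gamma>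
    using sub[OF that] unfolding submodule_iff by (auto simp: restrict_scalars_def)
  show "x \<oplus>\<^bsub>M\<^esub> y \<in> grade M \<gamma>" if "\<gamma> \<in> carrier \<Gamma>" "x \<in> grade M \<gamma>" "y \<in> grade M \<gamma>" for \<gamma> x y
    using sub[OF that(1)] that unfolding submodule_iff by (auto simp: restrict_scalars_def)
  fix x assume x: "x \<in> carrier M"
  have fs: "finsum (restrict_scalars A M) c F = finsum M c F" for c :: "'g \<Rightarrow> 'm" and F
    by (rule finsum_cong_record) (auto simp: restrict_scalars_def)
  have z: "\<zero>\<^bsub>restrict_scalars A M\<^esub> = \<zero>\<^bsub>M\<^esub>" "carrier (restrict_scalars A M) = carrier M"
    by (auto simp: restrict_scalars_def)
  show "\<exists>!c. (\<forall>\<gamma> \<in> carrier \<Gamma>. c \<gamma> \<in> grade M \<gamma>) \<and> (\<forall>\<gamma>. \<gamma> \<notin> carrier \<Gamma> \<longrightarrow> c \<gamma> = \<zero>\<^bsub>M\<^esub>) \<and>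
        finite {\<gamma>. c \<gamma> \<noteq> \<zero>\<^bsub>M\<^esub>} \<and> x = finsum M c {\<gamma>. c \<gamma> \<noteq> \<zero>\<^bsub>M\<^esub>}"
    using mod.decomposition x unfolding direct_sum_decomposition_def fs z by blast
qed (rule mod.M.abelian_group_axioms)

end

sublocale graded_module \<subseteq> gr: direct_sum_projections "carrier \<Gamma>" M "grade M" proj
  unfolding proj_def using ex_projections by (rule someI_ex)

context graded_module
begin

lemma smult_add_span_homogeneous:
  assumes S: "S \<subseteq> carrier M"
    and closed: "\<And>\<alpha> a s. \<lbrakk>\<alpha> \<in> carrier \<Gamma>; a \<in> grade A \<alpha>; s \<in> S\<rbrakk> \<Longrightarrow> a \<odot>\<^bsub>M\<^esub> s \<in> add_span M S"
    and a: "a \<in> carrier A" and x: "x \<in> add_span M S"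
  shows "a \<odot>\<^bsub>M\<^esub> x \<in> add_span M S"
  using a
proof (induction rule: alg.gr.carrier_induct)
  have xM: "x \<in> carrier M" using x mod.M.add_span_closed[OF S] by auto
  case zero
  then show ?case using xM by (simp add: mod.zero_smult add_span.zero)
next
  case (add \<alpha> s a)
  have xM: "x \<in> carrier M" using x mod.M.add_span_closed[OF S] by auto
  have s: "s \<in> carrier A" using add alg.gr.D_carrierI by auto
  have "s \<odot>\<^bsub>M\<^esub> x \<in> add_span M S"
    using add.hyps(1,2) closed by (intro mod.smult_add_span[OF s S S _ x])
  then show ?case using add s xM S by (auto simp: mod.smult_l_distr intro: mod.M.add_span_add)
qed

text \<open>The source of all graded submodules below.  A projection maps each homogeneous generator to
itself or to zero, hence maps the span into itself, so the projections of \<open>M\<close> restrict.\<close>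
lemma homogeneous_span_graded_submodule:
  assumes S: "S \<subseteq> (\<Union>\<gamma>\<in>carrier \<Gamma>. grade M \<gamma>)"
    and closed: "\<And>\<alpha> a s. \<lbrakk>\<alpha> \<in> carrier \<Gamma>; a \<in> grade A \<alpha>; s \<in> S\<rbrakk> \<Longrightarrow> a \<odot>\<^bsub>M\<^esub> s \<in> add_span M S"
  shows "graded_submodule R \<Gamma> A M (add_span M S)"
proof -
  let ?N = "add_span M S"
  let ?M = "M\<lparr>carrier := ?N, grade := (\<lambda>\<gamma>. ?N \<inter> grade M \<gamma>)\<rparr>"
  have SM: "S \<subseteq> carrier M" using S gr.D_union by auto
  have SN: "S \<subseteq> ?N" by (rule mod.M.add_span_incl[OF SM])
  have NM: "?N \<subseteq> carrier M" by (rule mod.M.add_span_closed[OF SM])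
  have sub: "submodule ?N A M"
    using NM add_span.zero mod.M.add_span_add[OF SM] smult_add_span_homogeneous[OF SM closed]
    by (rule mod.submoduleI)
  have M': "left_module A ?M" using sub by (rule mod.left_module_submodule) auto
  have "direct_sum_projections (carrier \<Gamma>) ?M (grade ?M) proj"
  proof (intro direct_sum_projections.intro direct_sum_projections_axioms.intro)
    show "abelian_group ?M" using M' by (simp add: left_module_def)
    have span: "add_span ?M T = add_span M T" for T by (rule add_span_cong) auto
    have "S \<subseteq> (\<Union>\<gamma>\<in>carrier \<Gamma>. ?N \<inter> grade M \<gamma>)" using S SN by auto
    then have "?N \<subseteq> add_span M (\<Union>\<gamma>\<in>carrier \<Gamma>. ?N \<inter> grade M \<gamma>)"
      using NM by (intro mod.M.add_span_mono) auto
    then show "carrier ?M \<subseteq> add_span ?M (\<Union>\<gamma>\<in>carrier \<Gamma>. grade ?M \<gamma>)"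
      unfolding span by simp
  qed (use NM SM in \<open>auto intro: gr.pr_add gr.pr_same gr.pr_other gr.D_zero add_span.zero
         mod.M.add_span_add gr.D_add\<close>)
  moreover have "a \<odot>\<^bsub>?M\<^esub> x \<in> grade ?M (\<alpha> \<otimes>\<^bsub>\<Gamma>\<^esub> \<gamma>)"
    if "\<alpha> \<in> carrier \<Gamma>" "\<gamma> \<in> carrier \<Gamma>" "a \<in> grade A \<alpha>" "x \<in> grade ?M \<gamma>" for \<alpha> \<gamma> a x
    using that mod.grade_smult sub alg.gr.D_carrierI[of \<alpha> a] by (auto simp: submodule_iff)
  ultimately have "graded_left_module R \<Gamma> A ?M"
    by (intro graded_left_moduleI alg.graded_algebra_axioms M')
  then show ?thesis unfolding graded_submodule_def using sub by simp
qed

end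

section \<open>Superfluous kernels have finite support\<close>

lemma (in abelian_monoid) set_add_add:
  assumes "H \<subseteq> carrier G" "\<And>x y. x \<in> H \<Longrightarrow> y \<in> H \<Longrightarrow> x \<oplus> y \<in> H"
    and "K \<subseteq> carrier G" "\<And>x y. x \<in> K \<Longrightarrow> y \<in> K \<Longrightarrow> x \<oplus> y \<in> K"
    and "x \<in> H <+>\<^bsub>G\<^esub> K" "y \<in> H <+>\<^bsub>G\<^esub> K"
  shows "x \<oplus> y \<in> H <+>\<^bsub>G\<^esub> K"
proof -
  obtain h k where x: "x = h \<oplus> k" "h \<in> H" "k \<in> K" using assms(5) by (auto simp: set_add_def')
  obtain h' k' where y: "y = h' \<oplus> k'" "h' \<in> H" "k' \<in> K" using assms(6) by (auto simp: set_add_def')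
  have "h \<in> carrier G" "k \<in> carrier G" "h' \<in> carrier G" "k' \<in> carrier G"
    using x y assms(1,3) by auto
  then have "x \<oplus> y = (h \<oplus> h') \<oplus> (k \<oplus> k')" unfolding x y by (simp add: a_ac)
  moreover have "h \<oplus> h' \<in> H" "k \<oplus> k' \<in> K" using assms(2,4) x y by auto
  ultimately show ?thesis unfolding set_add_def' by blast
qed

lemma (in abelian_monoid) subset_set_add:
  assumes "H \<subseteq> carrier G" "\<zero> \<in> H" "K \<subseteq> carrier G" "\<zero> \<in> K"
  shows "H \<subseteq> H <+>\<^bsub>G\<^esub> K" "K \<subseteq> H <+>\<^bsub>G\<^esub> K"
proof -
  show "H \<subseteq> H <+>\<^bsub>G\<^esub> K"
  proof
    fix h assume "h \<in> H"
    then have "h = h \<oplus> \<zero>" using assms by auto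
    then show "h \<in> H <+>\<^bsub>G\<^esub> K" using \<open>h \<in> H\<close> assms unfolding set_add_def' by blast
  qed
  show "K \<subseteq> H <+>\<^bsub>G\<^esub> K"
  proof
    fix k assume "k \<in> K"
    then have "k = \<zero> \<oplus> k" using assms by auto
    then show "k \<in> H <+>\<^bsub>G\<^esub> K" using \<open>k \<in> K\<close> assms unfolding set_add_def' by blast
  qed
qed

context graded_module
begin

text \<open>The set \<open>K + T\<close> is closed under addition and \<open>M\<close> is generated by homogeneous elements,
so these are the only ones that have to be decomposed.\<close>
lemma superfluous_homogeneous:
  assumes K: "superfluous (graded_submodule R \<Gamma> A M) M K"
    and T: "graded_submodule R \<Gamma> A M T"
    and hom: "\<And>\<gamma> x. \<gamma> \<in> carrier \<Gamma> \<Longrightarrow> x \<in> grade M \<gamma> \<Longrightarrow> x \<in> K <+>\<^bsub>M\<^esub> T"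
  shows "T = carrier M"
proof -
  have sub: "submodule K A M" "submodule T A M"
    using K T unfolding superfluous_def graded_submodule_def by auto
  have "x \<in> K <+>\<^bsub>M\<^esub> T" if "x \<in> carrier M" for x
    using that
  proof (induction rule: gr.carrier_induct)
    case zero
    then show ?case using mod.M.subset_set_add[of K T] sub by (auto simp: submodule_iff)
  next
    case (add \<gamma> s x)
    then show ?case using hom sub by (intro mod.M.set_add_add) (auto simp: submodule_iff)
  qed
  moreover have "K <+>\<^bsub>M\<^esub> T \<subseteq> carrier M" using sub by (auto simp: set_add_def' submodule_iff)
  ultimately have "K <+>\<^bsub>M\<^esub> T = carrier M" by auto
  then show ?thesis using K T unfolding superfluous_def by auto
qed

text \<open>Let \<open>T\<close> be the graded submodule generated by the \<open>grade M \<delta>\<close> with \<open>\<delta>\<close> in the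
support of \<open>N\<close>.  Homogeneous elements of any other degree are mapped to zero, so \<open>T\<close> and
the kernel together give \<open>M\<close>, and \<open>T = M\<close> because the kernel is superfluous.  But the
degrees occurring in \<open>T\<close> are products of a degree of \<open>A\<close> and a degree of \<open>N\<close>.\<close>
lemma finite_supp_of_superfluous_kernel:
  assumes N: "graded_left_module R \<Gamma> A N" and d: "d \<in> graded_hom \<Gamma> A M N"
    and K: "superfluous (graded_submodule R \<Gamma> A M) M (a_kernel M N d)"
    and fin: "finite (supp \<Gamma> A)" "finite (supp \<Gamma> N)"
  shows "finite (supp \<Gamma> M)"
proof -
  interpret N: graded_module R \<Gamma> A N
    using N alg.graded_algebra_axioms by (simp add: graded_module_def)
  let ?K = "a_kernel M N d"
  define S where "S = {a \<odot>\<^bsub>M\<^esub> p | a p \<alpha> \<delta>. \<alpha> \<in> carrier \<Gamma> \<and> \<delta> \<in> supp \<Gamma> N \<and> a \<in> grade A \<alpha> \<and> p \<in> grade M \<delta>}"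
  have supp: "\<delta> \<in> carrier \<Gamma>" if "\<delta> \<in> supp \<Gamma> N" for \<delta> using that by (simp add: supp_def)
  have SM: "S \<subseteq> (\<Union>\<gamma>\<in>carrier \<Gamma>. grade M \<gamma>)"
  proof
    fix s assume "s \<in> S"
    then obtain a p \<alpha> \<delta> where "s = a \<odot>\<^bsub>M\<^esub> p" "\<alpha> \<in> carrier \<Gamma>" "\<delta> \<in> carrier \<Gamma>" "a \<in> grade A \<alpha>" "p \<in> grade M \<delta>"
      using supp unfolding S_def by blast
    then have "s \<in> grade M (\<alpha> \<otimes>\<^bsub>\<Gamma>\<^esub> \<delta>)" "\<alpha> \<otimes>\<^bsub>\<Gamma>\<^esub> \<delta> \<in> carrier \<Gamma>"
      using mod.grade_smult by auto
    then show "s \<in> (\<Union>\<gamma>\<in>carrier \<Gamma>. grade M \<gamma>)" by blast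
  qed
  then have SM': "S \<subseteq> carrier M" using gr.D_union by auto
  have closed: "a \<odot>\<^bsub>M\<^esub> s \<in> S" if a: "\<alpha> \<in> carrier \<Gamma>" "a \<in> grade A \<alpha>" and s: "s \<in> S" for \<alpha> a s
  proof -
    obtain b p \<beta> \<delta> where s: "s = b \<odot>\<^bsub>M\<^esub> p" "\<beta> \<in> carrier \<Gamma>" "\<delta> \<in> supp \<Gamma> N" "b \<in> grade A \<beta>" "p \<in> grade M \<delta>"
      using s unfolding S_def by auto
    have "a \<odot>\<^bsub>M\<^esub> s = (a \<otimes>\<^bsub>A\<^esub> b) \<odot>\<^bsub>M\<^esub> p"
      unfolding s(1) using a s supp gr.D_carrierI alg.gr.D_carrierI by (subst mod.smult_assoc) auto
    moreover have "a \<otimes>\<^bsub>A\<^esub> b \<in> grade A (\<alpha> \<otimes>\<^bsub>\<Gamma>\<^esub> \<beta>)" using a s alg.grade_mult by auto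
    ultimately show ?thesis unfolding S_def using a s by blast
  qed
  have T: "graded_submodule R \<Gamma> A M (add_span M S)"
    using SM closed mod.M.add_span_incl[OF SM'] by (intro homogeneous_span_graded_submodule) auto
  have "add_span M S = carrier M"
    using K T
  proof (rule superfluous_homogeneous)
    fix \<gamma> x assume \<gamma>: "\<gamma> \<in> carrier \<Gamma>" "x \<in> grade M \<gamma>"
    have sub: "submodule ?K A M" using K unfolding superfluous_def graded_submodule_def by auto
    have "?K \<subseteq> carrier M" "\<zero>\<^bsub>M\<^esub> \<in> ?K" using sub by (auto simp: submodule_iff)
    note incl = mod.M.subset_set_add[OF this mod.M.add_span_closed[OF SM'] add_span.zero]
    have x: "x \<in> carrier M" using \<gamma> gr.D_carrierI by auto
    have "x \<in> ?K \<or> x \<in> S"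
    proof (cases "\<gamma> \<in> supp \<Gamma> N")
      case True
      have "x = \<one>\<^bsub>A\<^esub> \<odot>\<^bsub>M\<^esub> x" "\<one>\<^bsub>\<Gamma>\<^esub> \<in> carrier \<Gamma>" using x mod.smult_one by auto
      then have "x \<in> S" unfolding S_def using True \<gamma> alg.grade_one by blast
      then show ?thesis ..
    next
      case False
      have "d x \<in> grade N \<gamma>" using d \<gamma> unfolding graded_hom_def by auto
      then have "d x = \<zero>\<^bsub>N\<^esub>" using False \<gamma> by (auto simp: supp_def)
      then show ?thesis using x by (simp add: a_kernel_def')
    qed
    then show "x \<in> ?K <+>\<^bsub>M\<^esub> add_span M S"
      using incl mod.M.add_span_incl[OF SM'] by blast
  qed
  moreover have "proj \<gamma> x = \<zero>\<^bsub>M\<^esub>"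
    if x: "x \<in> add_span M S" and \<gamma>: "\<gamma> \<in> carrier \<Gamma>"
      "\<gamma> \<notin> (\<lambda>(\<alpha>, \<delta>). \<alpha> \<otimes>\<^bsub>\<Gamma>\<^esub> \<delta>) ` (supp \<Gamma> A \<times> supp \<Gamma> N)" for x \<gamma>
    using x
  proof induction
    case zero
    then show ?case using \<gamma> by (simp add: gr.pr_zero)
  next
    case (add s x)
    obtain b p \<beta> \<delta> where s: "s = b \<odot>\<^bsub>M\<^esub> p" "\<beta> \<in> carrier \<Gamma>" "\<delta> \<in> supp \<Gamma> N" "b \<in> grade A \<beta>" "p \<in> grade M \<delta>"
      using add unfolding S_def by auto
    have "proj \<gamma> s = \<zero>\<^bsub>M\<^esub>"
    proof (cases "\<gamma> = \<beta> \<otimes>\<^bsub>\<Gamma>\<^esub> \<delta>")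
      case True
      then have "\<beta> \<notin> supp \<Gamma> A" using \<gamma> s by auto
      then have "b = \<zero>\<^bsub>A\<^esub>" using s by (auto simp: supp_def)
      then have "s = \<zero>\<^bsub>M\<^esub>" using s mod.zero_smult gr.D_carrierI[OF supp] by simp
      then show ?thesis using \<gamma> by (simp add: gr.pr_zero)
    next
      case False
      then show ?thesis using s \<gamma> supp mod.grade_smult by (intro gr.pr_other) auto
    qed
    moreover have "s \<in> carrier M" "x \<in> carrier M" using add SM' mod.M.add_span_closed[OF SM'] by auto
    ultimately show ?case using add \<gamma> by (simp add: gr.pr_add)
  qed
  ultimately have zero: "proj \<gamma> x = \<zero>\<^bsub>M\<^esub>" if "x \<in> carrier M" "\<gamma> \<in> carrier \<Gamma>"
      "\<gamma> \<notin> (\<lambda>(\<alpha>, \<delta>). \<alpha> \<otimes>\<^bsub>\<Gamma>\<^esub> \<delta>) ` (supp \<Gamma> A \<times> supp \<Gamma> N)" for x \<gamma>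
    using that by simp
  have "supp \<Gamma> M \<subseteq> (\<lambda>(\<alpha>, \<delta>). \<alpha> \<otimes>\<^bsub>\<Gamma>\<^esub> \<delta>) ` (supp \<Gamma> A \<times> supp \<Gamma> N)"
  proof
    fix \<gamma> assume \<gamma>: "\<gamma> \<in> supp \<Gamma> M"
    then have \<gamma>': "\<gamma> \<in> carrier \<Gamma>" by (simp add: supp_def)
    then obtain x where x: "x \<in> grade M \<gamma>" "x \<noteq> \<zero>\<^bsub>M\<^esub>"
      using \<gamma> gr.D_zero[OF \<gamma>'] by (auto simp: supp_def)
    then have "proj \<gamma> x \<noteq> \<zero>\<^bsub>M\<^esub>" using gr.pr_same[OF \<gamma>'] by simp
    then show "\<gamma> \<in> (\<lambda>(\<alpha>, \<delta>). \<alpha> \<otimes>\<^bsub>\<Gamma>\<^esub> \<delta>) ` (supp \<Gamma> A \<times> supp \<Gamma> N)"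
      using zero[OF gr.D_carrierI[OF \<gamma>' x(1)] \<gamma>'] by blast
  qed
  then show ?thesis using fin finite_subset by blast
qed

end

section \<open>Superfluous submodules and the forgetful functor\<close>

text \<open>As \<open>e\<close> is the least degree and multiplication is strictly monotone, homogeneous scalars of
any other degree strictly raise degrees (\<open>less_mult\<close>).\<close>
locale positively_graded_module = graded_module R \<Gamma> A M + ord: ordered_monoid \<Gamma> lt
  for R :: "('r, 'z) ring_scheme" and \<Gamma> :: "('g, 'w) monoid_scheme"
    and A :: "('r, 'a, 'g, 'x) graded_scheme" and M :: "('a, 'm, 'g, 'y) graded_scheme"
    and lt :: "'g \<Rightarrow> 'g \<Rightarrow> bool" +
  assumes one_least: "\<gamma> \<in> carrier \<Gamma> \<Longrightarrow> \<gamma> = \<one>\<^bsub>\<Gamma>\<^esub> \<or> lt \<one>\<^bsub>\<Gamma>\<^esub> \<gamma>"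
begin

lemma less_mult:
  assumes "\<alpha> \<in> carrier \<Gamma>" "\<delta> \<in> carrier \<Gamma>" "\<alpha> \<noteq> \<one>\<^bsub>\<Gamma>\<^esub>"
  shows "lt \<delta> (\<alpha> \<otimes>\<^bsub>\<Gamma>\<^esub> \<delta>)"
  using ord.mult_less_right[of "\<one>\<^bsub>\<Gamma>\<^esub>" \<alpha> \<delta>] one_least[of \<alpha>] assms by auto

text \<open>Generators of \<open>A\<^sub>+ M\<close>, where \<open>A\<^sub>+\<close> is the ideal of elements of \<open>A\<close> without component
in degree \<open>e\<close>.\<close>
definition positive_part :: "'m set" where
  "positive_part = {a \<odot>\<^bsub>M\<^esub> x | a x \<alpha>. \<alpha> \<in> carrier \<Gamma> \<and> \<alpha> \<noteq> \<one>\<^bsub>\<Gamma>\<^esub> \<and> a \<in> grade A \<alpha> \<and> x \<in> carrier M}"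

lemma positive_part_carrier: "positive_part \<subseteq> carrier M"
  unfolding positive_part_def using mod.smult_closed alg.gr.D_carrierI by auto

text \<open>Modulo \<open>A\<^sub>+ M\<close>, which \<open>T\<close> contains, only scalars of degree \<open>e\<close> act, and
these preserve degrees.  Therefore replacing \<open>grade M \<gamma>\<close> by its part in \<open>T\<close>, while keeping all other components whole,
still gives a graded submodule \<open>U\<close>, although \<open>T\<close> itself is not graded.  The hypothesis on
\<open>T\<close> yields \<open>K + U = M\<close>, so \<open>U = M\<close>, which says that \<open>T\<close> contains
\<open>grade M \<gamma>\<close>.\<close>
lemma absorb_degree:
  assumes K: "superfluous (graded_submodule R \<Gamma> A M) M K"
    and T: "submodule T A M" "positive_part \<subseteq> T"
    and \<gamma>: "\<gamma> \<in> carrier \<Gamma>" and TK: "carrier M \<subseteq> T <+>\<^bsub>M\<^esub> (K \<inter> grade M \<gamma>)"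
  shows "T = carrier M"
proof -
  define S where "S = (T \<inter> grade M \<gamma>) \<union> (\<Union>\<delta>\<in>carrier \<Gamma> - {\<gamma>}. grade M \<delta>)"
  have SM: "S \<subseteq> (\<Union>\<gamma>\<in>carrier \<Gamma>. grade M \<gamma>)" unfolding S_def using \<gamma> by auto
  then have SM': "S \<subseteq> carrier M" using gr.D_union by auto
  have sub: "submodule K A M" using K unfolding superfluous_def graded_submodule_def by auto
  have closed: "a \<odot>\<^bsub>M\<^esub> s \<in> S" if a: "\<alpha> \<in> carrier \<Gamma>" "a \<in> grade A \<alpha>" and s: "s \<in> S" for \<alpha> a s
  proof -
    obtain \<delta> where \<delta>: "\<delta> \<in> carrier \<Gamma>" "s \<in> grade M \<delta>" using s SM by auto
    have as: "a \<odot>\<^bsub>M\<^esub> s \<in> grade M (\<alpha> \<otimes>\<^bsub>\<Gamma>\<^esub> \<delta>)" using a \<delta> mod.grade_smult by auto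
    show ?thesis
    proof (cases "\<alpha> \<otimes>\<^bsub>\<Gamma>\<^esub> \<delta> = \<gamma>")
      case True
      have "a \<odot>\<^bsub>M\<^esub> s \<in> T"
      proof (cases "\<alpha> = \<one>\<^bsub>\<Gamma>\<^esub>")
        case e: True
        then have "\<delta> = \<gamma>" using True \<delta> by simp
        moreover have "s = \<zero>\<^bsub>M\<^esub>" if "s \<in> grade M \<gamma>" "s \<in> grade M \<delta>'" "\<delta>' \<in> carrier \<Gamma>" "\<delta>' \<noteq> \<gamma>" for \<delta>'
          using gr.pr_same[OF \<gamma> that(1)] gr.pr_other[OF \<gamma> that(3) _ that(2)] that by auto
        ultimately have "s \<in> T" using s \<delta> T(1) unfolding S_def submodule_iff by auto
        then show ?thesis using T a alg.gr.D_carrierI unfolding submodule_iff by auto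
      next
        case False
        then have "a \<odot>\<^bsub>M\<^esub> s \<in> positive_part" using a s SM' unfolding positive_part_def by auto
        then show ?thesis using T by auto
      qed
      then show ?thesis using True as unfolding S_def by auto
    next
      case False
      then show ?thesis using as a \<delta> unfolding S_def by auto
    qed
  qed
  have U: "graded_submodule R \<Gamma> A M (add_span M S)"
    using SM closed mod.M.add_span_incl[OF SM'] by (intro homogeneous_span_graded_submodule) auto
  have "add_span M S = carrier M"
    using K U
  proof (rule superfluous_homogeneous)
    fix \<delta> x assume x: "\<delta> \<in> carrier \<Gamma>" "x \<in> grade M \<delta>"
    have *: "K \<subseteq> carrier M" "\<zero>\<^bsub>M\<^esub> \<in> K" "add_span M S \<subseteq> carrier M" "\<zero>\<^bsub>M\<^esub> \<in> add_span M S"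
      using sub mod.M.add_span_closed[OF SM'] add_span.zero unfolding submodule_iff by auto
    show "x \<in> K <+>\<^bsub>M\<^esub> add_span M S"
    proof (cases "\<delta> = \<gamma>")
      case True
      then have xM: "x \<in> carrier M" "x \<in> grade M \<gamma>" using x gr.D_carrierI by auto
      then obtain t k where tk: "x = t \<oplus>\<^bsub>M\<^esub> k" "t \<in> T" "k \<in> K" "k \<in> grade M \<gamma>"
        using TK by (auto simp: set_add_def')
      have tkM: "t \<in> carrier M" "k \<in> carrier M" using T(1) tk * by (auto simp: submodule_iff)
      \<comment> \<open>\<open>t\<close> is a difference of elements of degree \<open>\<gamma>\<close>, hence lies in \<open>U\<close>.\<close>
      have "t = proj \<gamma> t"
      proof -
        have "x = proj \<gamma> t \<oplus>\<^bsub>M\<^esub> k"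
          using gr.pr_add[OF \<gamma> tkM] gr.pr_same[OF \<gamma>] tk xM by auto
        then show ?thesis using tk(1) tkM gr.pr_carrier[OF \<gamma>] mod.M.add.right_cancel by auto
      qed
      then have "t \<in> S" using gr.pr_in[OF \<gamma> tkM(1)] tk unfolding S_def by auto
      then have "t \<in> add_span M S" using mod.M.add_span_incl[OF SM'] by auto
      moreover have "x = k \<oplus>\<^bsub>M\<^esub> t" using tk tkM mod.M.a_comm by auto
      ultimately show ?thesis using tk by (auto simp: set_add_def')
    next
      case False
      then have "x \<in> add_span M S" using x mod.M.add_span_incl[OF SM'] unfolding S_def by auto
      then show ?thesis using mod.M.subset_set_add(2)[OF *] by auto
    qed
  qed
  moreover have "proj \<gamma> x \<in> T" if "x \<in> add_span M S" for x
    using that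
  proof induction
    case zero
    then show ?case using T \<gamma> by (simp add: gr.pr_zero submodule_iff)
  next
    case (add s x)
    have "proj \<gamma> s \<in> T"
    proof (cases "s \<in> T \<inter> grade M \<gamma>")
      case True
      then show ?thesis using gr.pr_same[OF \<gamma>] by auto
    next
      case False
      then obtain \<delta> where "\<delta> \<in> carrier \<Gamma>" "\<delta> \<noteq> \<gamma>" "s \<in> grade M \<delta>" using add(1) unfolding S_def by auto
      then show ?thesis using gr.pr_other[OF \<gamma>] T(1) by (simp add: submodule_iff)
    qed
    moreover have "s \<in> carrier M" "x \<in> carrier M" using add SM' mod.M.add_span_closed[OF SM'] by auto
    ultimately show ?case using add T(1) \<gamma> by (simp add: gr.pr_add submodule_iff)
  qed
  ultimately have "proj \<gamma> x \<in> T" if "x \<in> grade M \<gamma>" for x using gr.D_carrierI[OF \<gamma> that] by simp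
  then have "grade M \<gamma> \<subseteq> T" using gr.pr_same[OF \<gamma>] by (metis subsetI)
  then have "T <+>\<^bsub>M\<^esub> (K \<inter> grade M \<gamma>) \<subseteq> T" using T(1) by (auto simp: set_add_def' submodule_iff)
  then show ?thesis using TK T(1) by (auto simp: submodule_iff)
qed

text \<open>A finite sum of superfluous submodules is superfluous; here the summands are the homogeneous
components of \<open>K\<close>, absorbed one after the other.\<close>
lemma absorb_degrees:
  assumes K: "superfluous (graded_submodule R \<Gamma> A M) M K"
    and T: "submodule T A M" "positive_part \<subseteq> T"
    and F: "finite F" "F \<subseteq> carrier \<Gamma>"
    and TK: "carrier M \<subseteq> add_span M (T \<union> (\<Union>\<gamma>\<in>F. K \<inter> grade M \<gamma>))"
  shows "T = carrier M"
  using F TK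
proof (induction F rule: finite_induct)
  case empty
  have "add_span M T \<subseteq> T" using T(1) by (intro add_span_least) (auto simp: submodule_iff)
  then show ?case using empty T(1) by (auto simp: submodule_iff)
next
  case (insert \<gamma> F)
  let ?S = "T \<union> (\<Union>\<gamma>\<in>F. K \<inter> grade M \<gamma>)"
  have sub: "submodule K A M" using K unfolding superfluous_def graded_submodule_def by auto
  have SM: "?S \<subseteq> carrier M" using sub T(1) by (auto simp: submodule_iff)
  have S: "?S \<subseteq> add_span M ?S" by (rule mod.M.add_span_incl[OF SM])
  have closed: "a \<odot>\<^bsub>M\<^esub> s \<in> add_span M ?S" if a: "\<alpha> \<in> carrier \<Gamma>" "a \<in> grade A \<alpha>" and s: "s \<in> ?S" for \<alpha> a s
  proof -
    have aA: "a \<in> carrier A" using a alg.gr.D_carrierI by auto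
    have "a \<odot>\<^bsub>M\<^esub> s \<in> ?S"
    proof (cases "s \<in> T")
      case True
      then show ?thesis using T(1) aA by (auto simp: submodule_iff)
    next
      case False
      then obtain \<delta> where \<delta>: "\<delta> \<in> F" "s \<in> K" "s \<in> grade M \<delta>" using s by auto
      show ?thesis
      proof (cases "\<alpha> = \<one>\<^bsub>\<Gamma>\<^esub>")
        case True
        have "\<delta> \<in> carrier \<Gamma>" using \<delta> insert.prems by auto
        then have "a \<odot>\<^bsub>M\<^esub> s \<in> grade M \<delta>" using mod.grade_smult[of \<alpha> \<delta> a s] a \<delta> True by simp
        then show ?thesis using \<delta> sub aA by (auto simp: submodule_iff)
      next
        case False
        then have "a \<odot>\<^bsub>M\<^esub> s \<in> positive_part" using a s SM unfolding positive_part_def by blast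
        then show ?thesis using T by auto
      qed
    qed
    then show ?thesis using S by auto
  qed
  have sub': "submodule (add_span M ?S) A M"
    using mod.M.add_span_closed[OF SM] add_span.zero mod.M.add_span_add[OF SM]
      smult_add_span_homogeneous[OF SM closed] by (rule mod.submoduleI)
  let ?K = "K \<inter> grade M \<gamma>"
  have \<gamma>: "\<gamma> \<in> carrier \<Gamma>" using insert by auto
  have KM: "?K \<subseteq> carrier M" "\<zero>\<^bsub>M\<^esub> \<in> ?K" using sub gr.D_zero[OF \<gamma>] by (auto simp: submodule_iff)
  note incl = mod.M.subset_set_add[OF mod.M.add_span_closed[OF SM] add_span.zero KM]
  have "add_span M (T \<union> (\<Union>\<gamma>\<in>insert \<gamma> F. K \<inter> grade M \<gamma>)) \<subseteq> add_span M ?S <+>\<^bsub>M\<^esub> ?K"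
  proof (rule add_span_least)
    show "T \<union> (\<Union>\<gamma>\<in>insert \<gamma> F. K \<inter> grade M \<gamma>) \<subseteq> add_span M ?S <+>\<^bsub>M\<^esub> ?K"
      using incl S by blast
    show "\<zero>\<^bsub>M\<^esub> \<in> add_span M ?S <+>\<^bsub>M\<^esub> ?K" using incl add_span.zero by blast
    show "x \<oplus>\<^bsub>M\<^esub> y \<in> add_span M ?S <+>\<^bsub>M\<^esub> ?K"
      if "x \<in> add_span M ?S <+>\<^bsub>M\<^esub> ?K" "y \<in> add_span M ?S <+>\<^bsub>M\<^esub> ?K" for x y
      using mod.M.add_span_closed[OF SM] mod.M.add_span_add[OF SM] KM(1) _ that
      by (rule mod.M.set_add_add) (use sub gr.D_add[OF \<gamma>] in \<open>auto simp: submodule_iff\<close>)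
  qed
  then have "add_span M ?S = carrier M"
    using insert.prems T(2) S by (intro absorb_degree[OF K sub' _ \<gamma>]) auto
  then show ?case using insert by auto
qed

text \<open>Nakayama's lemma for \<open>A\<^sub>+\<close>, which acts nilpotently on a module with finite support.
Suppose that \<open>T\<close> and the components with degrees in an upward closed subset \<open>U\<close> of the support
generate \<open>M\<close>.  Multiplying by \<open>A\<^sub>+\<close>, which strictly raises degrees, and using
\<open>M = T + A\<^sub>+ M\<close>, a minimal element can be removed from \<open>U\<close>.  Starting with the whole
support, one reaches \<open>U = {}\<close>.\<close>
lemma graded_nakayama:
  assumes fin: "finite (supp \<Gamma> M)" and T: "submodule T A M"
    and gen: "carrier M \<subseteq> add_span M (T \<union> positive_part)"
  shows "T = carrier M"
proof -
  have TM: "T \<subseteq> carrier M" using T by (simp add: submodule_iff)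
  have "T = carrier M"
    if "finite U" "U \<subseteq> supp \<Gamma> M" "\<And>\<gamma> \<delta>. \<gamma> \<in> U \<Longrightarrow> \<delta> \<in> supp \<Gamma> M \<Longrightarrow> lt \<gamma> \<delta> \<Longrightarrow> \<delta> \<in> U"
      "carrier M \<subseteq> add_span M (T \<union> (\<Union>\<delta>\<in>U. grade M \<delta>))" for U
    using that
  proof (induction U rule: finite_psubset_induct)
    case (psubset U)
    have U: "U \<subseteq> carrier \<Gamma>" using psubset.prems(1) by (auto simp: supp_def)
    show ?case
    proof (cases "U = {}")
      case True
      have "add_span M T \<subseteq> T" using T by (intro add_span_least) (auto simp: submodule_iff)
      then show ?thesis using True psubset.prems(3) TM by auto
    next
      case False
      have "\<exists>\<gamma>\<in>U. \<forall>\<delta>\<in>U. \<delta> \<noteq> \<gamma> \<longrightarrow> \<not> lt \<delta> \<gamma>"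
      proof (rule Finite_Set.bex_min_element[OF psubset.hyps _ _ False])
        show "asymp_on U lt"
        proof (rule asymp_onI)
          fix \<alpha> \<beta> assume "\<alpha> \<in> U" "\<beta> \<in> U" "lt \<alpha> \<beta>"
          then show "\<not> lt \<beta> \<alpha>" using U ord.less_irrefl[of \<alpha>] ord.less_trans[of \<alpha> \<beta> \<alpha>] by auto
        qed
        show "transp_on U lt"
        proof (rule transp_onI)
          fix \<alpha> \<beta> \<delta> assume "\<alpha> \<in> U" "\<beta> \<in> U" "\<delta> \<in> U" "lt \<alpha> \<beta>" "lt \<beta> \<delta>"
          then show "lt \<alpha> \<delta>" using U ord.less_trans[of \<alpha> \<beta> \<delta>] by auto
        qed
      qed
      then obtain \<gamma> where "\<gamma> \<in> U" and min: "\<And>\<delta>. \<delta> \<in> U \<Longrightarrow> \<delta> \<noteq> \<gamma> \<Longrightarrow> \<not> lt \<delta> \<gamma>" by auto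
      then have \<gamma>: "\<gamma> \<in> U" "\<And>\<delta>. \<delta> \<in> U \<Longrightarrow> \<not> lt \<delta> \<gamma>"
        using U ord.less_irrefl[of \<gamma>] by auto
      let ?S = "T \<union> (\<Union>\<delta>\<in>U. grade M \<delta>)"
      let ?S' = "T \<union> (\<Union>\<delta>\<in>U - {\<gamma>}. grade M \<delta>)"
      have SM: "?S \<subseteq> carrier M" "?S' \<subseteq> carrier M" using TM U gr.D_carrier by blast+
      note S' = mod.M.add_span_incl[OF SM(2)]
      have "a \<odot>\<^bsub>M\<^esub> x \<in> add_span M ?S'"
        if a: "\<alpha> \<in> carrier \<Gamma>" "\<alpha> \<noteq> \<one>\<^bsub>\<Gamma>\<^esub>" "a \<in> grade A \<alpha>" and x: "x \<in> carrier M" for \<alpha> a x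
      proof (rule mod.smult_add_span[OF _ SM])
        show aA: "a \<in> carrier A" using a alg.gr.D_carrierI by auto
        show "x \<in> add_span M ?S" using x psubset.prems(3) by auto
        fix s assume "s \<in> ?S"
        then consider "s \<in> T" | \<delta> where "\<delta> \<in> U" "s \<in> grade M \<delta>" by blast
        then show "a \<odot>\<^bsub>M\<^esub> s \<in> add_span M ?S'"
        proof cases
          case 1
          then show ?thesis using T aA S' by (auto simp: submodule_iff)
        next
          case 2
          let ?d = "\<alpha> \<otimes>\<^bsub>\<Gamma>\<^esub> \<delta>"
          have \<delta>: "\<delta> \<in> carrier \<Gamma>" using 2 U by auto
          have d: "?d \<in> carrier \<Gamma>" "a \<odot>\<^bsub>M\<^esub> s \<in> grade M ?d" using 2 \<delta> a mod.grade_smult by auto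
          have less: "lt \<delta> ?d" using a \<delta> by (intro less_mult)
          show ?thesis
          proof (cases "?d \<in> supp \<Gamma> M")
            case True
            then have "?d \<in> U" using psubset.prems(2) 2 less by auto
            moreover have "?d \<noteq> \<gamma>" using less \<gamma>(2)[of \<delta>] 2 by auto
            ultimately show ?thesis using d S' by blast
          next
            case False
            then have "a \<odot>\<^bsub>M\<^esub> s = \<zero>\<^bsub>M\<^esub>" using d by (auto simp: supp_def)
            then show ?thesis by (simp add: add_span.zero)
          qed
        qed
      qed
      then have "positive_part \<subseteq> add_span M ?S'" unfolding positive_part_def by auto
      then have "T \<union> positive_part \<subseteq> add_span M ?S'" using S' by simp
      then have "add_span M (T \<union> positive_part) \<subseteq> add_span M ?S'"
        by (rule add_span_least[OF _ add_span.zero mod.M.add_span_add[OF SM(2)]])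
      then have "carrier M \<subseteq> add_span M ?S'" using gen by auto
      moreover have "\<delta> \<in> U - {\<gamma>}" if "\<gamma>' \<in> U - {\<gamma>}" "\<delta> \<in> supp \<Gamma> M" "lt \<gamma>' \<delta>" for \<gamma>' \<delta>
        using that psubset.prems(2) \<gamma>(2) by auto
      moreover have "U - {\<gamma>} \<subset> U" "U - {\<gamma>} \<subseteq> supp \<Gamma> M" using \<gamma>(1) psubset.prems(1) by auto
      ultimately show ?thesis using psubset.IH[of "U - {\<gamma>}"] by blast
    qed
  qed
  moreover have "carrier M \<subseteq> add_span M (T \<union> (\<Union>\<delta>\<in>supp \<Gamma> M. grade M \<delta>))"
  proof -
    have SM: "T \<union> (\<Union>\<delta>\<in>supp \<Gamma> M. grade M \<delta>) \<subseteq> carrier M"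
      using TM gr.D_carrier by (auto simp: supp_def)
    have "(\<Union>\<gamma>\<in>carrier \<Gamma>. grade M \<gamma>) \<subseteq> add_span M (T \<union> (\<Union>\<delta>\<in>supp \<Gamma> M. grade M \<delta>))"
    proof (clarify)
      fix \<gamma> x assume "\<gamma> \<in> carrier \<Gamma>" "x \<in> grade M \<gamma>"
      then have "x = \<zero>\<^bsub>M\<^esub> \<or> x \<in> T \<union> (\<Union>\<delta>\<in>supp \<Gamma> M. grade M \<delta>)" by (auto simp: supp_def)
      then show "x \<in> add_span M (T \<union> (\<Union>\<delta>\<in>supp \<Gamma> M. grade M \<delta>))"
        using mod.M.add_span_incl[OF SM] add_span.zero by blast
    qed
    from add_span_least[OF this add_span.zero mod.M.add_span_add[OF SM]] gr.spanned
    show ?thesis by auto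
  qed
  ultimately show ?thesis using fin by blast
qed

text \<open>If \<open>K + T = M\<close>, then the components of \<open>K\<close> can be absorbed into \<open>T + A\<^sub>+ M\<close>, so this
submodule is all of \<open>M\<close>, and Nakayama's lemma gives \<open>T = M\<close>.\<close>
lemma superfluous_forget_grading:
  assumes fin: "finite (supp \<Gamma> M)"
    and K: "superfluous (graded_submodule R \<Gamma> A M) M K"
  shows "superfluous (\<lambda>N. submodule N A M) M K"
proof -
  have Kg: "graded_submodule R \<Gamma> A M K" using K by (simp add: superfluous_def)
  then have sub: "submodule K A M" by (simp add: graded_submodule_def)
  have "T = carrier M" if T: "submodule T A M" and KT: "K <+>\<^bsub>M\<^esub> T = carrier M" for T
  proof -
    let ?S = "T \<union> positive_part"
    have SM: "?S \<subseteq> carrier M" using T positive_part_carrier by (auto simp: submodule_iff)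
    note S = mod.M.add_span_incl[OF SM]
    have closed: "a \<odot>\<^bsub>M\<^esub> s \<in> add_span M ?S"
      if a: "\<alpha> \<in> carrier \<Gamma>" "a \<in> grade A \<alpha>" and s: "s \<in> ?S" for \<alpha> a s
    proof (cases "\<alpha> = \<one>\<^bsub>\<Gamma>\<^esub>")
      case False
      then have "a \<odot>\<^bsub>M\<^esub> s \<in> positive_part" using a s SM unfolding positive_part_def by blast
      then show ?thesis using S by auto
    next
      case True
      have aA: "a \<in> carrier A" using a alg.gr.D_carrierI by auto
      have "a \<odot>\<^bsub>M\<^esub> s \<in> ?S" if s: "s \<in> positive_part"
      proof -
        obtain b x \<beta> where b: "s = b \<odot>\<^bsub>M\<^esub> x" "\<beta> \<in> carrier \<Gamma>" "\<beta> \<noteq> \<one>\<^bsub>\<Gamma>\<^esub>" "b \<in> grade A \<beta>" "x \<in> carrier M"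
          using s unfolding positive_part_def by blast
        have "a \<odot>\<^bsub>M\<^esub> s = (a \<otimes>\<^bsub>A\<^esub> b) \<odot>\<^bsub>M\<^esub> x"
          unfolding b(1) using aA b alg.gr.D_carrierI by (subst mod.smult_assoc) auto
        moreover have "a \<otimes>\<^bsub>A\<^esub> b \<in> grade A \<beta>" using alg.grade_mult[OF a(1) b(2) a(2) b(4)] True b by simp
        ultimately show ?thesis unfolding positive_part_def using b by blast
      qed
      then show ?thesis using s T aA S by (auto simp: submodule_iff)
    qed
    have sub1: "submodule (add_span M ?S) A M"
      using mod.M.add_span_closed[OF SM] add_span.zero mod.M.add_span_add[OF SM]
        smult_add_span_homogeneous[OF SM closed] by (rule mod.submoduleI)
    let ?T = "add_span M ?S \<union> (\<Union>\<gamma>\<in>supp \<Gamma> M. K \<inter> grade M \<gamma>)"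
    have TM: "?T \<subseteq> carrier M" using mod.M.add_span_closed[OF SM] sub by (auto simp: submodule_iff)
    note Tincl = mod.M.add_span_incl[OF TM]
    have "K \<subseteq> add_span M ?T"
    proof -
      let ?K = "M\<lparr>carrier := K, grade := (\<lambda>\<gamma>. K \<inter> grade M \<gamma>)\<rparr>"
      interpret K: graded_module R \<Gamma> A ?K
        using Kg alg.graded_algebra_axioms unfolding graded_submodule_def graded_module_def by auto
      have "add_span ?K X = add_span M X" for X by (rule add_span_cong) auto
      then have "K \<subseteq> add_span M (\<Union>\<gamma>\<in>carrier \<Gamma>. K \<inter> grade M \<gamma>)" using K.gr.spanned by simp
      moreover have "(\<Union>\<gamma>\<in>carrier \<Gamma>. K \<inter> grade M \<gamma>) \<subseteq> add_span M ?T"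
      proof clarify
        fix \<gamma> x assume "\<gamma> \<in> carrier \<Gamma>" "x \<in> grade M \<gamma>" "x \<in> K"
        then have "x = \<zero>\<^bsub>M\<^esub> \<or> x \<in> ?T" by (auto simp: supp_def)
        then show "x \<in> add_span M ?T" using Tincl add_span.zero by blast
      qed
      then have "add_span M (\<Union>\<gamma>\<in>carrier \<Gamma>. K \<inter> grade M \<gamma>) \<subseteq> add_span M ?T"
        by (rule add_span_least[OF _ add_span.zero mod.M.add_span_add[OF TM]])
      ultimately show ?thesis by auto
    qed
    moreover have "T \<subseteq> add_span M ?T" using S Tincl by auto
    ultimately have "carrier M \<subseteq> add_span M ?T"
      unfolding KT[symmetric] using mod.M.add_span_add[OF TM] by (auto simp: set_add_def')
    then have "add_span M ?S = carrier M"
      using S fin by (intro absorb_degrees[OF K sub1]) (auto simp: supp_def)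
    then show ?thesis using graded_nakayama[OF fin T] by simp
  qed
  then show ?thesis using sub unfolding superfluous_def by auto
qed

end

section \<open>Free graded modules\<close>

definition free_carrier :: "('a, 'z) ring_scheme \<Rightarrow> 'j set \<Rightarrow> ('j \<Rightarrow> 'a) set" where
  "free_carrier A J = {u. (\<forall>j. u j \<in> carrier A) \<and> (\<forall>j. j \<notin> J \<longrightarrow> u j = \<zero>\<^bsub>A\<^esub>) \<and> finite {j. u j \<noteq> \<zero>\<^bsub>A\<^esub>}}"

text \<open>The algebra \<open>A\<close> regraded so that \<open>1\<close> has degree \<open>\<delta>\<close>: the part of degree
\<open>\<gamma>\<close> collects all \<open>grade A \<alpha>\<close> with \<open>\<alpha>\<delta> = \<gamma>\<close>.\<close>
definition shifted_grade ::
  "('g, 'w) monoid_scheme \<Rightarrow> ('r, 'a, 'g, 'x) graded_scheme \<Rightarrow> 'g \<Rightarrow> 'g \<Rightarrow> 'a set" where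
  "shifted_grade \<Gamma> A \<delta> \<gamma> = add_span A (\<Union>\<alpha>\<in>{\<alpha>\<in>carrier \<Gamma>. \<alpha> \<otimes>\<^bsub>\<Gamma>\<^esub> \<delta> = \<gamma>}. grade A \<alpha>)"

text \<open>The free module on \<open>J\<close> with the basis element \<open>j\<close> in degree \<open>deg j\<close>, realised by the
finitely supported functions from \<open>J\<close> to \<open>A\<close>.\<close>
definition free_graded ::
  "('g, 'w) monoid_scheme \<Rightarrow> ('r, 'a, 'g, 'x) graded_scheme \<Rightarrow> 'j set \<Rightarrow> ('j \<Rightarrow> 'g) \<Rightarrow>
    ('a, 'j \<Rightarrow> 'a, 'g) graded" where
  "free_graded \<Gamma> A J deg = \<lparr>carrier = free_carrier A J, monoid.mult = undefined, one = undefined,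
    ring.zero = (\<lambda>j. \<zero>\<^bsub>A\<^esub>), add = (\<lambda>u v j. u j \<oplus>\<^bsub>A\<^esub> v j), smult = (\<lambda>a u j. a \<otimes>\<^bsub>A\<^esub> u j),
    grade = (\<lambda>\<gamma>. {u \<in> free_carrier A J. \<forall>j\<in>J. u j \<in> shifted_grade \<Gamma> A (deg j) \<gamma>})\<rparr>"

definition single :: "('a, 'z) ring_scheme \<Rightarrow> 'j \<Rightarrow> 'a \<Rightarrow> 'j \<Rightarrow> 'a" where
  "single A j a = (\<lambda>i. if i = j then a else \<zero>\<^bsub>A\<^esub>)"

lemma (in ring) free_carrier_add:
  assumes "u \<in> free_carrier R J" "v \<in> free_carrier R J"
  shows "(\<lambda>j. u j \<oplus> v j) \<in> free_carrier R J"
proof -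
  have "{j. u j \<oplus> v j \<noteq> \<zero>} \<subseteq> {j. u j \<noteq> \<zero>} \<union> {j. v j \<noteq> \<zero>}" by auto
  then have "finite {j. u j \<oplus> v j \<noteq> \<zero>}"
    using assms by (elim finite_subset) (auto simp: free_carrier_def)
  then show ?thesis using assms by (auto simp: free_carrier_def)
qed

lemma (in ring) free_carrier_smult:
  assumes u: "u \<in> free_carrier R J" and a: "a \<in> carrier R"
  shows "(\<lambda>j. a \<otimes> u j) \<in> free_carrier R J"
proof -
  have "{j. a \<otimes> u j \<noteq> \<zero>} \<subseteq> {j. u j \<noteq> \<zero>}" using a by auto
  then have "finite {j. a \<otimes> u j \<noteq> \<zero>}"
    using u by (elim finite_subset) (auto simp: free_carrier_def)
  then show ?thesis using u a by (auto simp: free_carrier_def)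
qed

lemma (in ring) single_in:
  assumes "j \<in> J" "a \<in> carrier R" shows "single R j a \<in> free_carrier R J"
proof -
  have "{i. single R j a i \<noteq> \<zero>} \<subseteq> {j}" by (auto simp: single_def)
  then have "finite {i. single R j a i \<noteq> \<zero>}" by (rule finite_subset) simp
  then show ?thesis using assms by (auto simp: free_carrier_def single_def)
qed

lemma (in ring) zero_in_free_carrier: "(\<lambda>j. \<zero>) \<in> free_carrier R J"
  by (simp add: free_carrier_def)

lemma (in graded_algebra) left_module_free_graded:
  "left_module A (free_graded \<Gamma> A J deg)"
proof -
  let ?F = "free_graded \<Gamma> A J deg"
  have mem: "u j \<in> carrier A" if "u \<in> free_carrier A J" for u j using that by (simp add: free_carrier_def)
  have "abelian_group ?F"
  proof (rule abelian_groupI)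
    fix u assume u: "u \<in> carrier ?F"
    then have uF: "u \<in> free_carrier A J" by (simp add: free_graded_def)
    let ?v = "\<lambda>j. (\<ominus>\<^bsub>A\<^esub> \<one>\<^bsub>A\<^esub>) \<otimes>\<^bsub>A\<^esub> u j"
    have "?v j \<oplus>\<^bsub>A\<^esub> u j = \<zero>\<^bsub>A\<^esub>" for j using mem[OF uF, of j] by (simp add: l_minus l_neg)
    then show "\<exists>v\<in>carrier ?F. v \<oplus>\<^bsub>?F\<^esub> u = \<zero>\<^bsub>?F\<^esub>"
      using free_carrier_smult[OF uF, of "\<ominus>\<^bsub>A\<^esub> \<one>\<^bsub>A\<^esub>"] by (intro bexI[of _ ?v]) (auto simp: free_graded_def)
  qed (auto simp: free_graded_def mem free_carrier_add zero_in_free_carrier a_assoc fun_eq_iff intro: a_comm)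
  then show ?thesis
    unfolding left_module_def left_module_axioms_def
    using ring_axioms
    by (auto simp: free_graded_def mem free_carrier_smult l_distr r_distr m_assoc fun_eq_iff)
qed

text \<open>The projections act coordinatewise, by those of the shifted algebra belonging to each basis
element.\<close>
lemma (in graded_algebra) graded_left_module_free_graded:
  assumes deg: "\<And>j. j \<in> J \<Longrightarrow> deg j \<in> carrier \<Gamma>"
  shows "graded_left_module R \<Gamma> A (free_graded \<Gamma> A J deg)"
proof -
  let ?F = "free_graded \<Gamma> A J deg"
  have "\<exists>q. direct_sum_projections (carrier \<Gamma>) A (shifted_grade \<Gamma> A (deg j)) q" if "j \<in> J" for j
  proof -
    have "(\<lambda>\<alpha>. \<alpha> \<otimes>\<^bsub>\<Gamma>\<^esub> deg j) \<in> carrier \<Gamma> \<rightarrow> carrier \<Gamma>" using deg that by auto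
    from gr.coarsening[OF this] show ?thesis unfolding shifted_grade_def .
  qed
  then obtain q where "\<And>j. j \<in> J \<Longrightarrow> direct_sum_projections (carrier \<Gamma>) A (shifted_grade \<Gamma> A (deg j)) (q j)"
    by metis
  then have q: "direct_sum_projections (carrier \<Gamma>) A (shifted_grade \<Gamma> A (deg j)) (q j)" if "j \<in> J" for j
    using that by blast
  have F: "carrier ?F = free_carrier A J" by (simp add: free_graded_def)
  interpret F: left_module A ?F by (rule left_module_free_graded)
  note q' = direct_sum_projections.D_zero[OF q] direct_sum_projections.D_add[OF q]
    direct_sum_projections.pr_add[OF q] direct_sum_projections.pr_same[OF q] direct_sum_projections.pr_other[OF q]
    direct_sum_projections.pr_zero[OF q] direct_sum_projections.pr_carrier[OF q]
  have mem: "u j \<in> carrier A" if "u \<in> free_carrier A J" for u j using that by (simp add: free_carrier_def)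
  have outside: "u j = \<zero>\<^bsub>A\<^esub>" if "u \<in> free_carrier A J" "j \<notin> J" for u j
    using that by (simp add: free_carrier_def)
  let ?H = "\<Union>\<gamma>\<in>carrier \<Gamma>. grade ?F \<gamma>"
  have H: "?H \<subseteq> carrier ?F" by (auto simp: free_graded_def)
  have single: "single A j a \<in> add_span ?F ?H" if j: "j \<in> J" and a: "a \<in> carrier A" for j a
    using a
  proof (induction rule: gr.carrier_induct)
    case zero
    have "single A j \<zero>\<^bsub>A\<^esub> = \<zero>\<^bsub>?F\<^esub>" by (auto simp: single_def free_graded_def)
    then show ?case by (simp add: add_span.zero)
  next
    case (add \<alpha> s a)
    have s: "s \<in> carrier A" using add gr.D_carrierI by auto
    have "s \<in> shifted_grade \<Gamma> A (deg j) (\<alpha> \<otimes>\<^bsub>\<Gamma>\<^esub> deg j)"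
    proof -
      have "(\<Union>\<alpha>'\<in>{\<alpha>'\<in>carrier \<Gamma>. \<alpha>' \<otimes>\<^bsub>\<Gamma>\<^esub> deg j = \<alpha> \<otimes>\<^bsub>\<Gamma>\<^esub> deg j}. grade A \<alpha>') \<subseteq> carrier A"
        using gr.D_carrierI by auto
      from add_span_incl[OF this] show ?thesis unfolding shifted_grade_def using add by auto
    qed
    moreover have "\<alpha> \<otimes>\<^bsub>\<Gamma>\<^esub> deg j \<in> carrier \<Gamma>" using add deg j by auto
    ultimately have "single A j s \<in> grade ?F (\<alpha> \<otimes>\<^bsub>\<Gamma>\<^esub> deg j)"
      using single_in[OF j s] q'(1) by (auto simp: free_graded_def single_def)
    then have "single A j s \<in> ?H" using \<open>\<alpha> \<otimes>\<^bsub>\<Gamma>\<^esub> deg j \<in> carrier \<Gamma>\<close> by blast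
    moreover have "single A j (s \<oplus>\<^bsub>A\<^esub> a) = single A j s \<oplus>\<^bsub>?F\<^esub> single A j a"
      using s add by (auto simp: single_def free_graded_def)
    ultimately show ?case using add by (simp add: add_span.add)
  qed
  have spanned: "u \<in> add_span ?F ?H" if "finite Z" "u \<in> free_carrier A J" "{j. u j \<noteq> \<zero>\<^bsub>A\<^esub>} \<subseteq> Z" for u Z
    using that
  proof (induction Z arbitrary: u rule: finite_induct)
    case empty
    then have "u = \<zero>\<^bsub>?F\<^esub>" by (auto simp: free_graded_def)
    then show ?case by (simp add: add_span.zero)
  next
    case (insert j Z)
    show ?case
    proof (cases "j \<in> J")
      case False
      then have "{j. u j \<noteq> \<zero>\<^bsub>A\<^esub>} \<subseteq> Z" using insert outside by blast
      then show ?thesis using insert by blast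
    next
      case True
      let ?v = "u(j := \<zero>\<^bsub>A\<^esub>)"
      have "{i. ?v i \<noteq> \<zero>\<^bsub>A\<^esub>} \<subseteq> {i. u i \<noteq> \<zero>\<^bsub>A\<^esub>}" by auto
      then have "finite {i. ?v i \<noteq> \<zero>\<^bsub>A\<^esub>}" using insert.prems(1) finite_subset unfolding free_carrier_def by blast
      then have v: "?v \<in> free_carrier A J" using insert.prems(1) by (auto simp: free_carrier_def)
      have "?v \<in> add_span ?F ?H" by (rule insert.IH[OF v]) (use insert.prems(2) in auto)
      moreover have "u = single A j (u j) \<oplus>\<^bsub>?F\<^esub> ?v"
        using mem[OF insert.prems(1)] by (auto simp: single_def free_graded_def fun_eq_iff)
      ultimately show ?thesis
        using F.M.add_span_add[OF H single[OF True mem[OF insert.prems(1)]]] by metis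
    qed
  qed
  have "direct_sum_projections (carrier \<Gamma>) ?F (grade ?F) (\<lambda>\<gamma> u j. if j \<in> J then q j \<gamma> (u j) else \<zero>\<^bsub>A\<^esub>)"
  proof
    show "carrier ?F \<subseteq> add_span ?F ?H"
    proof
      fix u assume u: "u \<in> carrier ?F"
      then have "finite {j. u j \<noteq> \<zero>\<^bsub>A\<^esub>}" unfolding F by (simp add: free_carrier_def)
      then show "u \<in> add_span ?F ?H" using u spanned[OF _ _ subset_refl] unfolding F by blast
    qed
    fix \<gamma> assume \<gamma>: "\<gamma> \<in> carrier \<Gamma>"
    show "grade ?F \<gamma> \<subseteq> carrier ?F" by (auto simp: free_graded_def)
    show "\<zero>\<^bsub>?F\<^esub> \<in> grade ?F \<gamma>" using \<gamma> q'(1) by (auto simp: free_graded_def zero_in_free_carrier)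
    show "u \<oplus>\<^bsub>?F\<^esub> v \<in> grade ?F \<gamma>" if "u \<in> grade ?F \<gamma>" "v \<in> grade ?F \<gamma>" for u v
      using that \<gamma> q'(2) by (auto simp: free_graded_def free_carrier_add)
    show "(\<lambda>j. if j \<in> J then q j \<gamma> ((u \<oplus>\<^bsub>?F\<^esub> v) j) else \<zero>\<^bsub>A\<^esub>) =
        (\<lambda>j. if j \<in> J then q j \<gamma> (u j) else \<zero>\<^bsub>A\<^esub>) \<oplus>\<^bsub>?F\<^esub> (\<lambda>j. if j \<in> J then q j \<gamma> (v j) else \<zero>\<^bsub>A\<^esub>)"
      if "u \<in> carrier ?F" "v \<in> carrier ?F" for u v
      using that \<gamma> q'(3) by (auto simp: free_graded_def mem fun_eq_iff)
    show "(\<lambda>j. if j \<in> J then q j \<gamma> (u j) else \<zero>\<^bsub>A\<^esub>) = u" if "u \<in> grade ?F \<gamma>" for u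
      using that \<gamma> q'(4) by (auto simp: free_graded_def fun_eq_iff outside)
    show "(\<lambda>j. if j \<in> J then q j \<gamma> (u j) else \<zero>\<^bsub>A\<^esub>) = \<zero>\<^bsub>?F\<^esub>"
      if "\<gamma>' \<in> carrier \<Gamma>" "\<gamma> \<noteq> \<gamma>'" "u \<in> grade ?F \<gamma>'" for u \<gamma>'
      using that \<gamma> q'(5) by (auto simp: free_graded_def fun_eq_iff)
  qed
  moreover have "a \<odot>\<^bsub>?F\<^esub> u \<in> grade ?F (\<alpha> \<otimes>\<^bsub>\<Gamma>\<^esub> \<gamma>)"
    if \<alpha>: "\<alpha> \<in> carrier \<Gamma>" "\<gamma> \<in> carrier \<Gamma>" "a \<in> grade A \<alpha>" and u: "u \<in> grade ?F \<gamma>" for \<alpha> \<gamma> a u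
  proof -
    have a: "a \<in> carrier A" using \<alpha> gr.D_carrierI by auto
    have "a \<otimes>\<^bsub>A\<^esub> x \<in> shifted_grade \<Gamma> A (deg j) (\<alpha> \<otimes>\<^bsub>\<Gamma>\<^esub> \<gamma>)"
      if j: "j \<in> J" and x: "x \<in> shifted_grade \<Gamma> A (deg j) \<gamma>" for j x
      using x unfolding shifted_grade_def
    proof induction
      case zero
      then show ?case using a by (simp add: add_span.zero)
    next
      case (add s x)
      let ?S = "\<lambda>\<gamma>. \<Union>\<alpha>\<in>{\<alpha> \<in> carrier \<Gamma>. \<alpha> \<otimes>\<^bsub>\<Gamma>\<^esub> deg j = \<gamma>}. grade A \<alpha>"
      have S: "?S \<gamma> \<subseteq> carrier A" for \<gamma> using gr.D_carrierI by auto
      obtain \<beta> where \<beta>: "\<beta> \<in> carrier \<Gamma>" "\<beta> \<otimes>\<^bsub>\<Gamma>\<^esub> deg j = \<gamma>" "s \<in> grade A \<beta>" using add by auto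
      have "s \<in> carrier A" "x \<in> carrier A" using add \<beta> gr.D_carrierI add_span_closed[OF S] by auto
      then have "a \<otimes>\<^bsub>A\<^esub> (s \<oplus>\<^bsub>A\<^esub> x) = a \<otimes>\<^bsub>A\<^esub> s \<oplus>\<^bsub>A\<^esub> a \<otimes>\<^bsub>A\<^esub> x" using a by (simp add: r_distr)
      moreover have "(\<alpha> \<otimes>\<^bsub>\<Gamma>\<^esub> \<beta>) \<otimes>\<^bsub>\<Gamma>\<^esub> deg j = \<alpha> \<otimes>\<^bsub>\<Gamma>\<^esub> \<gamma>"
        using \<alpha> \<beta> deg[OF j] monoid.m_assoc[OF graded_algebra.axioms(1)[OF graded_algebra_axioms], of \<alpha> \<beta> "deg j"]
        by simp
      then have "a \<otimes>\<^bsub>A\<^esub> s \<in> ?S (\<alpha> \<otimes>\<^bsub>\<Gamma>\<^esub> \<gamma>)" using \<alpha> \<beta> grade_mult[of \<alpha> \<beta> a s] by auto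
      ultimately show ?case using add by (simp add: add_span.add)
    qed
    then show ?thesis using u a by (auto simp: free_graded_def free_carrier_smult)
  qed
  ultimately show ?thesis
    by (intro graded_left_moduleI left_module_free_graded graded_algebra_axioms)
qed

text \<open>The value at \<open>u\<close> of the linear map from the free module that sends each basis element \<open>j\<close>
to \<open>\<xi> j\<close>.\<close>
definition lin_ext :: "('a, 'm, 'x) module_scheme \<Rightarrow> ('a, 'z) ring_scheme \<Rightarrow> ('j \<Rightarrow> 'm) \<Rightarrow> ('j \<Rightarrow> 'a) \<Rightarrow> 'm" where
  "lin_ext M A \<xi> u = finsum M (\<lambda>j. u j \<odot>\<^bsub>M\<^esub> \<xi> j) {j. u j \<noteq> \<zero>\<^bsub>A\<^esub>}"

context left_module
begin

lemma lin_ext_superset: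
  assumes "u \<in> free_carrier A J" "\<xi> \<in> J \<rightarrow> carrier M" "finite F" "F \<subseteq> J" "{j. u j \<noteq> \<zero>\<^bsub>A\<^esub>} \<subseteq> F"
  shows "lin_ext M A \<xi> u = finsum M (\<lambda>j. u j \<odot>\<^bsub>M\<^esub> \<xi> j) F"
  unfolding lin_ext_def using assms
  by (intro M.finsum_superset) (auto simp: free_carrier_def Pi_iff zero_smult intro!: smult_closed)

lemma lin_ext_single:
  assumes "a \<in> carrier A" "\<xi> j \<in> carrier M"
  shows "lin_ext M A \<xi> (single A j a) = a \<odot>\<^bsub>M\<^esub> \<xi> j"
proof -
  have "lin_ext M A \<xi> (single A j a) = finsum M (\<lambda>i. single A j a i \<odot>\<^bsub>M\<^esub> \<xi> i) {j}"
    using assms A.single_in[of j "{j}" a] by (intro lin_ext_superset[of _ "{j}"]) (auto simp: single_def)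
  also have "\<dots> = a \<odot>\<^bsub>M\<^esub> \<xi> j" using assms smult_closed by (simp add: M.finsum_insert single_def)
  finally show ?thesis .
qed

end

lemma lin_ext_hom:
  fixes A :: "('r, 'a, 'g, 'x) graded_scheme"
  assumes M: "left_module A M" and \<xi>: "\<xi> \<in> J \<rightarrow> carrier M"
  shows "lin_ext M A \<xi> \<in> left_module_hom A (free_graded \<Gamma> A J deg) M"
proof -
  interpret left_module A M by fact
  have mem: "u j \<in> carrier A" if "u \<in> free_carrier A J" for u j using that by (simp add: free_carrier_def)
  have supp: "{j. u j \<noteq> \<zero>\<^bsub>A\<^esub>} \<subseteq> J" "finite {j. u j \<noteq> \<zero>\<^bsub>A\<^esub>}" if "u \<in> free_carrier A J" for u
    using that by (auto simp: free_carrier_def)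
  have summand: "u j \<odot>\<^bsub>M\<^esub> \<xi> j \<in> carrier M" if "u \<in> free_carrier A J" "j \<in> J" for u j
    using that \<xi> by (auto intro!: smult_closed mem)
  have closed: "lin_ext M A \<xi> u \<in> carrier M" if "u \<in> free_carrier A J" for u
    unfolding lin_ext_def using that supp[OF that] by (intro M.finsum_closed) (auto intro: summand)
  have add: "lin_ext M A \<xi> (\<lambda>j. u j \<oplus>\<^bsub>A\<^esub> v j) = lin_ext M A \<xi> u \<oplus>\<^bsub>M\<^esub> lin_ext M A \<xi> v"
    if u: "u \<in> free_carrier A J" and v: "v \<in> free_carrier A J" for u v
  proof -
    let ?F = "{j. u j \<noteq> \<zero>\<^bsub>A\<^esub>} \<union> {j. v j \<noteq> \<zero>\<^bsub>A\<^esub>}"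
    let ?w = "\<lambda>j. u j \<oplus>\<^bsub>A\<^esub> v j"
    have F: "finite ?F" "?F \<subseteq> J" using supp u v by auto
    have "{j. ?w j \<noteq> \<zero>\<^bsub>A\<^esub>} \<subseteq> ?F" by auto
    then have "lin_ext M A \<xi> ?w = finsum M (\<lambda>j. ?w j \<odot>\<^bsub>M\<^esub> \<xi> j) ?F"
      using \<xi> F by (intro lin_ext_superset[OF A.free_carrier_add[OF u v]])
    also have "\<dots> = finsum M (\<lambda>j. u j \<odot>\<^bsub>M\<^esub> \<xi> j \<oplus>\<^bsub>M\<^esub> v j \<odot>\<^bsub>M\<^esub> \<xi> j) ?F"
    proof (rule M.finsum_cong'[OF refl])
      fix j assume "j \<in> ?F"
      then show "?w j \<odot>\<^bsub>M\<^esub> \<xi> j = u j \<odot>\<^bsub>M\<^esub> \<xi> j \<oplus>\<^bsub>M\<^esub> v j \<odot>\<^bsub>M\<^esub> \<xi> j"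
        using F \<xi> by (intro smult_l_distr mem u v) auto
    qed (use F u v summand in auto)
    also have "\<dots> = finsum M (\<lambda>j. u j \<odot>\<^bsub>M\<^esub> \<xi> j) ?F \<oplus>\<^bsub>M\<^esub> finsum M (\<lambda>j. v j \<odot>\<^bsub>M\<^esub> \<xi> j) ?F"
      using F u v summand by (intro M.finsum_addf) auto
    also have "finsum M (\<lambda>j. u j \<odot>\<^bsub>M\<^esub> \<xi> j) ?F = lin_ext M A \<xi> u"
      using lin_ext_superset[OF u \<xi> F] by simp
    also have "finsum M (\<lambda>j. v j \<odot>\<^bsub>M\<^esub> \<xi> j) ?F = lin_ext M A \<xi> v"
      using lin_ext_superset[OF v \<xi> F] by simp
    finally show ?thesis .
  qed
  have smult: "lin_ext M A \<xi> (\<lambda>j. a \<otimes>\<^bsub>A\<^esub> u j) = a \<odot>\<^bsub>M\<^esub> lin_ext M A \<xi> u"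
    if a: "a \<in> carrier A" and u: "u \<in> free_carrier A J" for a u
  proof -
    let ?F = "{j. u j \<noteq> \<zero>\<^bsub>A\<^esub>}"
    have "{j. a \<otimes>\<^bsub>A\<^esub> u j \<noteq> \<zero>\<^bsub>A\<^esub>} \<subseteq> ?F" using a by auto
    then have "lin_ext M A \<xi> (\<lambda>j. a \<otimes>\<^bsub>A\<^esub> u j) = finsum M (\<lambda>j. (a \<otimes>\<^bsub>A\<^esub> u j) \<odot>\<^bsub>M\<^esub> \<xi> j) ?F"
      using \<xi> supp[OF u] by (intro lin_ext_superset[OF A.free_carrier_smult[OF u a]])
    also have "\<dots> = finsum M (\<lambda>j. a \<odot>\<^bsub>M\<^esub> (u j \<odot>\<^bsub>M\<^esub> \<xi> j)) ?F"
    proof (rule M.finsum_cong'[OF refl])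
      fix j assume "j \<in> ?F"
      then show "(a \<otimes>\<^bsub>A\<^esub> u j) \<odot>\<^bsub>M\<^esub> \<xi> j = a \<odot>\<^bsub>M\<^esub> (u j \<odot>\<^bsub>M\<^esub> \<xi> j)"
        using supp(1)[OF u] \<xi> by (intro smult_assoc a mem u) auto
    qed (use supp(1)[OF u] a u summand smult_closed in auto)
    also have "\<dots> = a \<odot>\<^bsub>M\<^esub> lin_ext M A \<xi> u"
      unfolding lin_ext_def using supp[OF u] a u summand
      by (intro finsum_hom[symmetric] M.abelian_monoid_axioms)
         (auto intro: smult_closed smult_zero smult_r_distr)
    finally show ?thesis .
  qed
  show ?thesis
    using closed add smult by (auto simp: left_module_hom_def free_graded_def)
qed

lemma hom_lin_ext:
  assumes M: "left_module A M" and N: "left_module A N" and g: "g \<in> left_module_hom A M N"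
    and u: "u \<in> free_carrier A J" and \<xi>: "\<xi> \<in> J \<rightarrow> carrier M"
  shows "g (lin_ext M A \<xi> u) = lin_ext N A (\<lambda>j. g (\<xi> j)) u"
proof -
  interpret M: left_module A M by fact
  interpret N: left_module A N by fact
  let ?F = "{j. u j \<noteq> \<zero>\<^bsub>A\<^esub>}"
  have F: "finite ?F" "?F \<subseteq> J" "\<And>j. u j \<in> carrier A" using u by (auto simp: free_carrier_def)
  have gM: "g \<in> carrier M \<rightarrow> carrier N" using g by (simp add: left_module_hom_def)
  have "g (lin_ext M A \<xi> u) = finsum N (\<lambda>j. g (u j \<odot>\<^bsub>M\<^esub> \<xi> j)) ?F"
    unfolding lin_ext_def
    using g F \<xi> left_module_hom_zero[OF M N g] gM M.smult_closed
    by (intro finsum_hom M.M.abelian_monoid_axioms N.M.abelian_monoid_axioms)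
       (auto simp: left_module_hom_def Pi_iff)
  also have "\<dots> = finsum N (\<lambda>j. u j \<odot>\<^bsub>N\<^esub> g (\<xi> j)) ?F"
  proof (rule N.M.finsum_cong'[OF refl])
    have \<xi>': "\<xi> j \<in> carrier M" if "j \<in> ?F" for j using that F \<xi> by auto
    show "(\<lambda>j. u j \<odot>\<^bsub>N\<^esub> g (\<xi> j)) \<in> ?F \<rightarrow> carrier N"
      using F \<xi>' gM by (auto intro!: N.smult_closed)
    show "g (u j \<odot>\<^bsub>M\<^esub> \<xi> j) = u j \<odot>\<^bsub>N\<^esub> g (\<xi> j)" if "j \<in> ?F" for j
      using g F(3) \<xi>'[OF that] by (simp add: left_module_hom_def)
  qed
  finally show ?thesis unfolding lin_ext_def .
qed

section \<open>Graded projective modules are projective\<close>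

text \<open>The copy of \<open>M\<close> along an injection \<open>s\<close> of its carrier into another type, with left inverse
\<open>p\<close>.\<close>
definition transport :: "('m \<Rightarrow> 'n) \<Rightarrow> ('n \<Rightarrow> 'm) \<Rightarrow> ('a, 'm, 'g, 'y) graded_scheme \<Rightarrow> ('a, 'n, 'g) graded" where
  "transport s p M = \<lparr>carrier = s ` carrier M, monoid.mult = undefined, one = undefined,
    ring.zero = s \<zero>\<^bsub>M\<^esub>, add = (\<lambda>x y. s (p x \<oplus>\<^bsub>M\<^esub> p y)), smult = (\<lambda>a x. s (a \<odot>\<^bsub>M\<^esub> p x)),
    grade = (\<lambda>\<gamma>. s ` grade M \<gamma>)\<rparr>"

lemma (in graded_module) graded_left_module_transport:
  assumes ps: "\<And>x. x \<in> carrier M \<Longrightarrow> p (s x) = x"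
  shows "graded_left_module R \<Gamma> A (transport s p M)"
proof -
  let ?N = "transport s p M"
  have ab: "abelian_group ?N"
  proof (rule abelian_groupI)
    fix y assume "y \<in> carrier ?N"
    then obtain x where x: "x \<in> carrier M" "y = s x" by (auto simp: transport_def)
    then show "\<exists>z\<in>carrier ?N. z \<oplus>\<^bsub>?N\<^esub> y = \<zero>\<^bsub>?N\<^esub>"
      by (intro bexI[of _ "s (\<ominus>\<^bsub>M\<^esub> x)"]) (auto simp: transport_def ps mod.M.l_neg)
  qed (auto simp: transport_def ps mod.M.a_ac)
  have lm: "left_module A ?N"
    unfolding left_module_def left_module_axioms_def using ab alg.ring_axioms
    by (auto simp: transport_def ps mod.smult_closed mod.smult_l_distr mod.smult_r_distr mod.smult_assoc mod.smult_one)
  have "direct_sum_projections (carrier \<Gamma>) ?N (grade ?N) (\<lambda>\<gamma> y. s (proj \<gamma> (p y)))"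
  proof (intro direct_sum_projections.intro direct_sum_projections_axioms.intro)
    show "abelian_group ?N" by fact
    have "s x \<in> add_span ?N (\<Union>\<gamma>\<in>carrier \<Gamma>. grade ?N \<gamma>)" if "x \<in> carrier M" for x
      using that
    proof (induction rule: gr.carrier_induct)
      case zero
      then show ?case using add_span.zero[of ?N] by (simp add: transport_def)
    next
      case (add \<gamma> h x)
      have "s h \<in> (\<Union>\<gamma>\<in>carrier \<Gamma>. grade ?N \<gamma>)" using add by (auto simp: transport_def)
      then have "s h \<oplus>\<^bsub>?N\<^esub> s x \<in> add_span ?N (\<Union>\<gamma>\<in>carrier \<Gamma>. grade ?N \<gamma>)"
        using add by (intro add_span.add)
      then show ?case using add gr.D_carrierI by (simp add: transport_def ps)
    qed
    then show "carrier ?N \<subseteq> add_span ?N (\<Union>\<gamma>\<in>carrier \<Gamma>. grade ?N \<gamma>)" by (auto simp: transport_def)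
  qed (auto simp: transport_def ps gr.D_carrierI gr.D_zero gr.D_add gr.pr_add gr.pr_same gr.pr_other
        gr.pr_carrier)
  moreover have "a \<odot>\<^bsub>?N\<^esub> x \<in> grade ?N (\<alpha> \<otimes>\<^bsub>\<Gamma>\<^esub> \<gamma>)"
    if "\<alpha> \<in> carrier \<Gamma>" "\<gamma> \<in> carrier \<Gamma>" "a \<in> grade A \<alpha>" "x \<in> grade ?N \<gamma>" for \<alpha> \<gamma> a x
    using that mod.grade_smult by (auto simp: transport_def ps gr.D_carrierI)
  ultimately show ?thesis by (intro graded_left_moduleI alg.graded_algebra_axioms lm)
qed

text \<open>Take for \<open>J\<close> the homogeneous elements of \<open>P\<close>, each in a degree in which it lives (the zero
element has no unique one; any choice will do), and let \<open>\<pi>\<close> be the canonical surjection from the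
free graded module \<open>F\<close> on \<open>J\<close> onto \<open>P\<close>.  Lifting the identity of \<open>P\<close> along
\<open>\<pi>\<close> splits \<open>\<pi>\<close>.  The lifting property is only available for modules with elements in
\<open>'m \<Rightarrow> 'a\<close>, the type of the elements of \<open>F\<close>; therefore \<open>P\<close> is first copied into \<open>F\<close> by a
set-theoretic section \<open>s\<close> of \<open>\<pi>\<close>.\<close>
lemma projective_graded_splits:
  fixes P :: "('a, 'm, 'g, 'y) graded_scheme" and A :: "('r, 'a, 'g, 'x) graded_scheme"
  assumes alg: "graded_algebra R \<Gamma> A"
    and P: "projective_graded_module TYPE('m \<Rightarrow> 'a) R \<Gamma> A P"
  shows "\<exists>(J :: 'm set) deg. J \<subseteq> carrier P \<and>
    (\<exists>h \<in> left_module_hom A P (free_graded \<Gamma> A J deg). \<forall>x \<in> carrier P. lin_ext P A (\<lambda>b. b) (h x) = x)"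
proof -
  interpret P: graded_module R \<Gamma> A P
    using alg P by (simp add: graded_module_def projective_graded_module_def)
  define J where "J = (\<Union>\<gamma>\<in>carrier \<Gamma>. grade P \<gamma>)"
  define deg where "deg b = (SOME \<gamma>. \<gamma> \<in> carrier \<Gamma> \<and> b \<in> grade P \<gamma>)" for b
  have deg: "deg b \<in> carrier \<Gamma> \<and> b \<in> grade P (deg b)" if "b \<in> J" for b
  proof -
    have "\<exists>\<gamma>. \<gamma> \<in> carrier \<Gamma> \<and> b \<in> grade P \<gamma>" using that by (auto simp: J_def)
    then show ?thesis unfolding deg_def by (rule someI_ex)
  qed
  have JP: "J \<subseteq> carrier P" unfolding J_def by (rule P.gr.D_union)
  then have id: "(\<lambda>b. b) \<in> J \<rightarrow> carrier P" by auto
  let ?F = "free_graded \<Gamma> A J deg"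
  let ?\<pi> = "lin_ext P A (\<lambda>b. b)"
  have Fg: "graded_left_module R \<Gamma> A ?F"
    using deg by (intro P.alg.graded_left_module_free_graded) auto
  then interpret F: graded_module R \<Gamma> A ?F using alg by (simp add: graded_module_def)
  have F: "carrier ?F = free_carrier A J" by (simp add: free_graded_def)
  have \<pi>: "?\<pi> \<in> left_module_hom A ?F P" by (rule lin_ext_hom[OF P.mod.left_module_axioms id])
  then have \<pi>_add: "\<And>u v. u \<in> carrier ?F \<Longrightarrow> v \<in> carrier ?F \<Longrightarrow> ?\<pi> (u \<oplus>\<^bsub>?F\<^esub> v) = ?\<pi> u \<oplus>\<^bsub>P\<^esub> ?\<pi> v"
    and \<pi>_smult: "\<And>a u. a \<in> carrier A \<Longrightarrow> u \<in> carrier ?F \<Longrightarrow> ?\<pi> (a \<odot>\<^bsub>?F\<^esub> u) = a \<odot>\<^bsub>P\<^esub> ?\<pi> u"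
    and \<pi>_closed: "\<And>u. u \<in> carrier ?F \<Longrightarrow> ?\<pi> u \<in> carrier P"
    by (auto simp: left_module_hom_def)
  have \<pi>_grade: "?\<pi> u \<in> grade P \<gamma>" if u: "u \<in> grade ?F \<gamma>" and \<gamma>: "\<gamma> \<in> carrier \<Gamma>" for u \<gamma>
  proof -
    have uF: "u \<in> free_carrier A J" using u by (simp add: free_graded_def)
    have "u j \<odot>\<^bsub>P\<^esub> j \<in> grade P \<gamma>" if j: "j \<in> J" for j
    proof -
      have "a \<odot>\<^bsub>P\<^esub> j \<in> grade P \<gamma>" if "a \<in> shifted_grade \<Gamma> A (deg j) \<gamma>" for a
        using that unfolding shifted_grade_def
      proof induction
        case zero
        then show ?case using JP j \<gamma> P.gr.D_zero by (auto simp: P.mod.zero_smult)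
      next
        case (add s a)
        let ?S = "\<Union>\<alpha>\<in>{\<alpha> \<in> carrier \<Gamma>. \<alpha> \<otimes>\<^bsub>\<Gamma>\<^esub> deg j = \<gamma>}. grade A \<alpha>"
        have S: "?S \<subseteq> carrier A" using P.alg.gr.D_carrierI by auto
        have sa: "s \<in> carrier A" "a \<in> carrier A" using add S P.alg.add_span_closed[OF S] by auto
        have "s \<odot>\<^bsub>P\<^esub> j \<in> grade P \<gamma>" using add(1) deg[OF j] P.mod.grade_smult by auto
        then show ?case using sa add JP j \<gamma> P.gr.D_add by (auto simp: P.mod.smult_l_distr)
      qed
      then show ?thesis using u j by (simp add: free_graded_def)
    qed
    moreover have "j \<in> J" if "u j \<noteq> \<zero>\<^bsub>A\<^esub>" for j using uF that by (auto simp: free_carrier_def)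
    ultimately show ?thesis
      unfolding lin_ext_def using uF \<gamma> P.gr.D_carrier P.gr.D_zero P.gr.D_add
      by (intro P.mod.M.finsum_in) (auto simp: free_carrier_def)
  qed
  have surj: "\<exists>u\<in>carrier ?F. ?\<pi> u = x" if "x \<in> carrier P" for x
    using that
  proof (induction rule: P.gr.carrier_induct)
    case zero
    then show ?case using left_module_hom_zero[OF F.mod.left_module_axioms P.mod.left_module_axioms \<pi>] by auto
  next
    case (add \<gamma> b x)
    then obtain u where u: "u \<in> carrier ?F" "?\<pi> u = x" by auto
    have b: "b \<in> J" using add by (auto simp: J_def)
    let ?b = "single A b \<one>\<^bsub>A\<^esub>"
    have "?b \<in> carrier ?F" unfolding F using b by (intro P.alg.single_in) auto
    moreover have "?\<pi> ?b = b" using b JP by (auto simp: P.mod.lin_ext_single P.mod.smult_one)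
    ultimately show ?case using u by (intro bexI[of _ "?b \<oplus>\<^bsub>?F\<^esub> u"]) (auto simp: \<pi>_add)
  qed
  define s where "s x = (SOME u. u \<in> carrier ?F \<and> ?\<pi> u = x)" for x
  have s: "s x \<in> carrier ?F" "?\<pi> (s x) = x" if "x \<in> carrier P" for x
    using someI_ex[of "\<lambda>u. u \<in> carrier ?F \<and> ?\<pi> u = x"] surj[OF that] unfolding s_def by auto
  let ?Y = "transport s ?\<pi> P"
  have Y: "graded_left_module R \<Gamma> A ?Y" using s by (intro P.graded_left_module_transport)
  have g: "(\<lambda>u. s (?\<pi> u)) \<in> graded_hom \<Gamma> A ?F ?Y"
    using \<pi>_grade \<pi>_closed \<pi>_add \<pi>_smult s
    by (auto simp: graded_hom_def left_module_hom_def transport_def)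
  moreover have "(\<lambda>u. s (?\<pi> u)) ` carrier ?F = carrier ?Y"
    using \<pi>_closed surj by (force simp: transport_def)
  moreover have "s \<in> graded_hom \<Gamma> A P ?Y"
    using s by (auto simp: graded_hom_def left_module_hom_def transport_def)
  ultimately obtain h where h: "h \<in> graded_hom \<Gamma> A P ?F" "\<And>x. x \<in> carrier P \<Longrightarrow> s (?\<pi> (h x)) = s x"
    using P Fg Y unfolding projective_graded_module_def by blast
  then have hh: "h \<in> left_module_hom A P ?F" by (simp add: graded_hom_def)
  have "?\<pi> (h x) = x" if x: "x \<in> carrier P" for x
  proof -
    have "h x \<in> carrier ?F" using hh x by (auto simp: left_module_hom_def)
    then have "?\<pi> (h x) \<in> carrier P" using \<pi> by (auto simp: left_module_hom_def)
    then show ?thesis using h(2)[OF x] s(2) x by metis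
  qed
  then show ?thesis using JP hh by blast
qed

text \<open>By the splitting, \<open>P\<close> is a direct summand of a free module, even after forgetting the grading.
To lift \<open>f\<close> along \<open>g\<close>, choose preimages \<open>\<xi> b\<close> of the \<open>f b\<close> for the basis elements
\<open>b\<close> and compose the resulting linear map from the free module with the splitting
\<open>h\<close>.\<close>
lemma projective_forget_grading:
  fixes P :: "('a, 'm, 'g, 'y) graded_scheme" and A :: "('r, 'a, 'g, 'x) graded_scheme"
  assumes alg: "graded_algebra R \<Gamma> A"
    and P: "projective_graded_module TYPE('m \<Rightarrow> 'a) R \<Gamma> A P"
  shows "projective_module TYPE('t) A P"
proof -
  have PA: "left_module A P"
    using P by (simp add: projective_graded_module_def graded_left_module_def)
  have "\<exists>h \<in> left_module_hom A P X. \<forall>p \<in> carrier P. g (h p) = f p"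
    if X: "left_module A X" and Y: "left_module A Y" and g: "g \<in> left_module_hom A X Y"
      and surj: "g ` carrier X = carrier Y" and f: "f \<in> left_module_hom A P Y"
    for X Y :: "('a, 't) module" and g f
  proof -
    obtain J :: "'m set" and deg h where J: "J \<subseteq> carrier P"
      and h: "h \<in> left_module_hom A P (free_graded \<Gamma> A J deg)"
      and split: "\<And>x. x \<in> carrier P \<Longrightarrow> lin_ext P A (\<lambda>b. b) (h x) = x"
      using projective_graded_splits[OF alg P] by auto
    have "\<exists>x\<in>carrier X. g x = f b" if "b \<in> J" for b
    proof -
      have "f b \<in> g ` carrier X" unfolding surj using f that J by (auto simp: left_module_hom_def)
      then show ?thesis by auto
    qed
    then obtain \<xi> where \<xi>: "\<And>b. b \<in> J \<Longrightarrow> \<xi> b \<in> carrier X \<and> g (\<xi> b) = f b" by metis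
    then have \<xi>X: "\<xi> \<in> J \<rightarrow> carrier X" by auto
    let ?k = "\<lambda>p. lin_ext X A \<xi> (h p)"
    have k: "lin_ext X A \<xi> \<in> left_module_hom A (free_graded \<Gamma> A J deg) X"
      using X \<xi>X by (rule lin_ext_hom)
    have "?k \<in> left_module_hom A P X" using h k by (auto simp: left_module_hom_def Pi_iff)
    moreover have "g (?k p) = f p" if p: "p \<in> carrier P" for p
    proof -
      have hp: "h p \<in> free_carrier A J" using h p by (auto simp: left_module_hom_def free_graded_def)
      have "g (?k p) = lin_ext Y A (\<lambda>b. g (\<xi> b)) (h p)" using hom_lin_ext[OF X Y g hp \<xi>X] .
      also have "\<dots> = lin_ext Y A f (h p)"
      proof -
        interpret Y: left_module A Y by fact
        have "b \<in> J" if "h p b \<noteq> \<zero>\<^bsub>A\<^esub>" for b using hp that by (auto simp: free_carrier_def)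
        moreover have "f b \<in> carrier Y" if "b \<in> J" for b using f J that by (auto simp: left_module_hom_def)
        ultimately show ?thesis
          unfolding lin_ext_def using \<xi> hp
          by (intro Y.M.finsum_cong') (auto simp: free_carrier_def intro!: Y.smult_closed)
      qed
      also have "\<dots> = f (lin_ext P A (\<lambda>b. b) (h p))"
      proof -
        have "(\<lambda>b. b) \<in> J \<rightarrow> carrier P" using J by auto
        from hom_lin_ext[OF PA Y f hp this] show ?thesis by simp
      qed
      finally show ?thesis using split[OF p] by simp
    qed
    ultimately show ?thesis by (intro bexI[of _ ?k] ballI)
  qed
  then show ?thesis unfolding projective_module_def using PA by blast
qed

section \<open>Forgetting the grading\<close>

lemma forget_grading_sel [simp]:
  "carrier (forget_grading M) = carrier M" "add (forget_grading M) = add M"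
  "\<zero>\<^bsub>forget_grading M\<^esub> = \<zero>\<^bsub>M\<^esub>" "smult (forget_grading M) = smult M"
  "monoid.mult (forget_grading M) = monoid.mult M" "\<one>\<^bsub>forget_grading M\<^esub> = \<one>\<^bsub>M\<^esub>"
  by (simp_all add: forget_grading_def module.defs)

lemma a_inv_forget [simp]: "\<ominus>\<^bsub>forget_grading M\<^esub> x = \<ominus>\<^bsub>M\<^esub> x"
  by (simp add: a_inv_def m_inv_def)

lemma left_module_forget:
  "left_module (forget_grading A) M \<longleftrightarrow> left_module A M"
  "left_module A (forget_grading N) \<longleftrightarrow> left_module A N"
  by (auto elim: left_module_cong)

lemma left_module_hom_forget:
  "left_module_hom (forget_grading A) M N = left_module_hom A M N"
  "left_module_hom A (forget_grading M') N = left_module_hom A M' N"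
  "left_module_hom A M (forget_grading N') = left_module_hom A M N'"
  by (simp_all add: left_module_hom_def)

lemma projective_module_forget:
  "projective_module TYPE('t) A P \<Longrightarrow> projective_module TYPE('t) (forget_grading A) (forget_grading P)"
  unfolding projective_module_def left_module_forget left_module_hom_forget forget_grading_sel .

lemma a_kernel_forget: "a_kernel (forget_grading M) (forget_grading N) f = a_kernel M N f"
  by (simp add: a_kernel_def')

lemma exact_complex_forget: "exact_complex (\<lambda>k. forget_grading (P k)) d \<longleftrightarrow> exact_complex P d"
  by (simp add: exact_complex_def a_kernel_forget)

lemma superfluous_forget:
  "superfluous (\<lambda>N. submodule N (forget_grading A) (forget_grading M)) (forget_grading M) K \<longleftrightarrow>
   superfluous (\<lambda>N. submodule N A M) M K"
  by (simp add: superfluous_def submodule_iff set_add_def')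

theorem theorem2p5:
  fixes R :: "'r ring"
    and \<Gamma> :: "'g monoid" and lt :: "'g \<Rightarrow> 'g \<Rightarrow> bool"
    and A :: "('r, 'a, 'g) graded"
    and M :: "('a, 'm, 'g) graded"
    and P :: "int \<Rightarrow> ('a, 'm, 'g) graded" and d :: "int \<Rightarrow> 'm \<Rightarrow> 'm"
  assumes "cring R"
    and "well_founded_ordered_monoid \<Gamma> lt"
    and "\<forall>\<gamma> \<in> carrier \<Gamma>. \<gamma> = \<one>\<^bsub>\<Gamma>\<^esub> \<or> lt \<one>\<^bsub>\<Gamma>\<^esub> \<gamma>"
    and "graded_algebra R \<Gamma> A" and "finite (supp \<Gamma> A)"
    and "graded_left_module R \<Gamma> A M" and "finite (supp \<Gamma> M)"
    and "minimal_graded_projective_resolution TYPE('m \<Rightarrow> 'a) R \<Gamma> A M P d"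
  shows "minimal_projective_resolution TYPE('t) (forget_grading A)
    (forget_grading M) (\<lambda>k. forget_grading (P k)) d"
proof -
  have P: "P (-1) = M" "\<And>k. k \<ge> -1 \<Longrightarrow> graded_left_module R \<Gamma> A (P k)"
    "\<And>k. k \<ge> -1 \<Longrightarrow> d k \<in> graded_hom \<Gamma> A (P (k + 1)) (P k)"
    "exact_complex P d"
    "\<And>k. k \<ge> 0 \<Longrightarrow> projective_graded_module TYPE('m \<Rightarrow> 'a) R \<Gamma> A (P k)"
    and min: "\<And>k. k \<ge> -1 \<Longrightarrow> superfluous (graded_submodule R \<Gamma> A (P (k + 1))) (P (k + 1))
        (a_kernel (P (k + 1)) (P k) (d k))"
    using assms(8)
    unfolding minimal_graded_projective_resolution_def graded_projective_resolution_def by auto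
  have graded: "graded_module R \<Gamma> A (P k)" if "k \<ge> -1" for k
    using assms(4) P(2)[OF that] by (simp add: graded_module_def)
  have fin: "finite (supp \<Gamma> (P k))" if "k \<ge> -1" for k
    using that
  proof (induction k rule: int_ge_induct)
    case base
    show ?case using assms(7) P(1) by simp
  next
    case (step k)
    show ?case
      using graded_module.finite_supp_of_superfluous_kernel[OF graded P(2)[OF step(1)] P(3) min]
        step assms(5) by auto
  qed
  have "superfluous (\<lambda>N. submodule N A (P (k + 1))) (P (k + 1)) (a_kernel (P (k + 1)) (P k) (d k))"
    if k: "k \<ge> -1" for k
  proof -
    have "positively_graded_module R \<Gamma> A (P (k + 1)) lt"
      using assms(2,3) graded[of "k + 1"] k
      by (simp add: positively_graded_module_def positively_graded_module_axioms_def
        well_founded_ordered_monoid_def)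
    then show ?thesis
      using fin[of "k + 1"] min[OF k] k by (intro positively_graded_module.superfluous_forget_grading) auto
  qed
  moreover have "projective_module TYPE('t) A (P k)" if "k \<ge> 0" for k
    using projective_forget_grading[OF assms(4) P(5)[OF that]] .
  moreover have "left_module A (P k)" if "k \<ge> -1" for k
    using P(2)[OF that] by (simp add: graded_left_module_def)
  moreover have "d k \<in> left_module_hom A (P (k + 1)) (P k)" if "k \<ge> -1" for k
    using P(3)[OF that] by (simp add: graded_hom_def)
  ultimately show ?thesis
    unfolding minimal_projective_resolution_def projective_resolution_def
    using P(1,4) by (simp add: left_module_forget left_module_hom_forget exact_complex_forget
      superfluous_forget a_kernel_forget projective_module_forget)
qed

end
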